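(* Let $A\in\mathcal{V}$ and let $\theta,\chi\in Con(A)$ with $\theta\subseteq\chi$ and $Max(A)\cap[\theta)_A=Max(A)\cap[\chi)_A$. If $\chi$ has $CBLP$ then $\theta$ has $CBLP$.
   Context: $\mathcal{V}$ is a congruence modular, semidegenerate variety (no nontrivial algebra has a one-element subalgebra) of finite signature. For $B\in\mathcal{V}$: $Con(B)$ is its congruence lattice with bounds $\Delta_B,\nabla_B$, $[\cdot,\cdot]$ the Freese–McKenzie commutator, $K(B)$ the compact congruences. A congruence $\phi\neq\nabla_B$ is prime if $[\alpha,\beta]\subseteq\phi$ implies $\alpha\subseteq\phi$ or $\beta\subseteq\phi$; $\rho(\theta)$ is the intersection of prime congruences containing $\theta$; $Max(B)$ is the set of maximal congruences; $[\theta)_B=\{\chi\in Con(B):\theta\subseteq\chi\}$. $B(Con(B))$ is the Boolean algebra of complemented elements of $Con(B)$. When $K(B)$ is closed under the commutator, the reticulation $L(B)=K(B)/{\equiv}$ ($\alpha\equiv\beta$ iff $\rho(\alpha)=\rho(\beta)$) is a bounded distributive lattice with canonical map $\lambda_B$, mapping $B(Con(B))$ injectively into $B(L(B))$; the reticulation preserves the Boolean center if this map is onto $B(L(B))$. Standing assumption: for every $B\in\mathcal{V}$, $K(B)$ is closed under the commutator and the reticulation of $B$ preserves the Boolean center. A congruence $\theta$ of $A$ has $CBLP$ if for every $\beta\in B(Con(A/\theta))$ there is $\alpha\in B(Con(A))$ with $(\alpha\vee\theta)/\theta=\beta$. *)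

theory Defs
  imports Main
begin

text \<open>An algebra: a carrier set and interpretations of the operation symbols
  (an operation symbol f of arity ar f is applied to lists of length ar f).\<close>

record ('f, 'a) alg =
  carr :: "'a set"
  ops  :: "'f \<Rightarrow> 'a list \<Rightarrow> 'a"

definition is_alg :: "('f \<Rightarrow> nat) \<Rightarrow> ('f, 'a) alg \<Rightarrow> bool" where
  "is_alg ar B \<longleftrightarrow> carr B \<noteq> {} \<and>
     (\<forall>f xs. length xs = ar f \<and> set xs \<subseteq> carr B \<longrightarrow> ops B f xs \<in> carr B)"

datatype ('f, 'v) trm = Var 'v | App 'f "('f, 'v) trm list"

fun wf_trm :: "('f \<Rightarrow> nat) \<Rightarrow> ('f, 'v) trm \<Rightarrow> bool" where
  "wf_trm ar (Var v) = True"
| "wf_trm ar (App f ts) = (length ts = ar f \<and> (\<forall>t\<in>set ts. wf_trm ar t))"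

fun eval :: "('f, 'a) alg \<Rightarrow> ('v \<Rightarrow> 'a) \<Rightarrow> ('f, 'v) trm \<Rightarrow> 'a" where
  "eval B s (Var v) = s v"
| "eval B s (App f ts) = ops B f (map (eval B s) ts)"

definition in_var :: "('f \<Rightarrow> nat) \<Rightarrow> (('f, nat) trm \<times> ('f, nat) trm) set \<Rightarrow> ('f, 'a) alg \<Rightarrow> bool" where
  "in_var ar E B \<longleftrightarrow> is_alg ar B \<and>
     (\<forall>(s, t)\<in>E. \<forall>\<sigma>. range \<sigma> \<subseteq> carr B \<longrightarrow> eval B \<sigma> s = eval B \<sigma> t)"

definition Con :: "('f \<Rightarrow> nat) \<Rightarrow> ('f, 'a) alg \<Rightarrow> ('a \<times> 'a) set set" where
  "Con ar B = {\<theta>. equiv (carr B) \<theta> \<and>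
     (\<forall>f xs ys. length xs = ar f \<and> length ys = ar f \<and> list_all2 (\<lambda>x y. (x, y) \<in> \<theta>) xs ys
        \<longrightarrow> (ops B f xs, ops B f ys) \<in> \<theta>)}"

definition Delta :: "('f, 'a) alg \<Rightarrow> ('a \<times> 'a) set" where
  "Delta B = Id_on (carr B)"

definition Nabla :: "('f, 'a) alg \<Rightarrow> ('a \<times> 'a) set" where
  "Nabla B = carr B \<times> carr B"

definition Cg :: "('f \<Rightarrow> nat) \<Rightarrow> ('f, 'a) alg \<Rightarrow> ('a \<times> 'a) set \<Rightarrow> ('a \<times> 'a) set" where
  "Cg ar B X = \<Inter>{\<theta> \<in> Con ar B. X \<subseteq> \<theta>}"

definition cjoin :: "('f \<Rightarrow> nat) \<Rightarrow> ('f, 'a) alg \<Rightarrow> ('a \<times> 'a) set \<Rightarrow> ('a \<times> 'a) set \<Rightarrow> ('a \<times> 'a) set" where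
  "cjoin ar B \<alpha> \<beta> = Cg ar B (\<alpha> \<union> \<beta>)"

definition cJoin :: "('f \<Rightarrow> nat) \<Rightarrow> ('f, 'a) alg \<Rightarrow> ('a \<times> 'a) set set \<Rightarrow> ('a \<times> 'a) set" where
  "cJoin ar B S = Cg ar B (\<Union>S)"

definition K :: "('f \<Rightarrow> nat) \<Rightarrow> ('f, 'a) alg \<Rightarrow> ('a \<times> 'a) set set" where
  "K ar B = {\<theta> \<in> Con ar B. \<forall>S \<subseteq> Con ar B. \<theta> \<subseteq> cJoin ar B S \<longrightarrow>
       (\<exists>S'. S' \<subseteq> S \<and> finite S' \<and> \<theta> \<subseteq> cJoin ar B S')}"

section \<open>The (Freese--McKenzie) commutator, via the term condition\<close>

text \<open>C(alpha, beta; delta): alpha centralizes beta modulo delta (term condition).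
  Variables Inl i form the tuple x, variables Inr j the tuple y of t(x, y).\<close>
definition centralizes :: "('f \<Rightarrow> nat) \<Rightarrow> ('f, 'a) alg \<Rightarrow> ('a \<times> 'a) set \<Rightarrow> ('a \<times> 'a) set \<Rightarrow> ('a \<times> 'a) set \<Rightarrow> bool" where
  "centralizes ar B \<alpha> \<beta> \<delta> \<longleftrightarrow>
     (\<forall>(t :: ('f, nat + nat) trm) a b c d. wf_trm ar t \<longrightarrow>
        (\<forall>i. (a i, b i) \<in> \<alpha>) \<longrightarrow> (\<forall>j. (c j, d j) \<in> \<beta>) \<longrightarrow>
        (eval B (case_sum a c) t, eval B (case_sum a d) t) \<in> \<delta> \<longrightarrow>
        (eval B (case_sum b c) t, eval B (case_sum b d) t) \<in> \<delta>)"

definition comm :: "('f \<Rightarrow> nat) \<Rightarrow> ('f, 'a) alg \<Rightarrow> ('a \<times> 'a) set \<Rightarrow> ('a \<times> 'a) set \<Rightarrow> ('a \<times> 'a) set" where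
  "comm ar B \<alpha> \<beta> = \<Inter>{\<delta> \<in> Con ar B. centralizes ar B \<alpha> \<beta> \<delta>}"

definition prime_con :: "('f \<Rightarrow> nat) \<Rightarrow> ('f, 'a) alg \<Rightarrow> ('a \<times> 'a) set \<Rightarrow> bool" where
  "prime_con ar B \<phi> \<longleftrightarrow> \<phi> \<in> Con ar B \<and> \<phi> \<noteq> Nabla B \<and>
     (\<forall>\<alpha>\<in>Con ar B. \<forall>\<beta>\<in>Con ar B. comm ar B \<alpha> \<beta> \<subseteq> \<phi> \<longrightarrow> \<alpha> \<subseteq> \<phi> \<or> \<beta> \<subseteq> \<phi>)"

text \<open>rho(theta): intersection of the prime congruences containing theta
  (the empty intersection being Nabla).\<close>
definition rho :: "('f \<Rightarrow> nat) \<Rightarrow> ('f, 'a) alg \<Rightarrow> ('a \<times> 'a) set \<Rightarrow> ('a \<times> 'a) set" where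
  "rho ar B \<theta> = Nabla B \<inter> \<Inter>{\<phi>. prime_con ar B \<phi> \<and> \<theta> \<subseteq> \<phi>}"

definition MaxCon :: "('f \<Rightarrow> nat) \<Rightarrow> ('f, 'a) alg \<Rightarrow> ('a \<times> 'a) set set" where
  "MaxCon ar B = {\<mu> \<in> Con ar B. \<mu> \<noteq> Nabla B \<and>
     (\<forall>\<psi>\<in>Con ar B. \<mu> \<subseteq> \<psi> \<longrightarrow> \<psi> = \<mu> \<or> \<psi> = Nabla B)}"

definition BCon :: "('f \<Rightarrow> nat) \<Rightarrow> ('f, 'a) alg \<Rightarrow> ('a \<times> 'a) set set" where
  "BCon ar B = {\<alpha> \<in> Con ar B. \<exists>\<beta>\<in>Con ar B. \<alpha> \<inter> \<beta> = Delta B \<and> cjoin ar B \<alpha> \<beta> = Nabla B}"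

text \<open>L(B) = K(B)/\<equiv> with [a] join [b] = [a join b], [a] meet [b] = [[a,b]],
  0 = [Delta], 1 = [Nabla], where a \<equiv> b iff rho a = rho b.  The class of a compact
  alpha is a Boolean element of L(B) iff it has a complement in L(B).\<close>
definition ret_boolean :: "('f \<Rightarrow> nat) \<Rightarrow> ('f, 'a) alg \<Rightarrow> ('a \<times> 'a) set \<Rightarrow> bool" where
  "ret_boolean ar B \<alpha> \<longleftrightarrow> \<alpha> \<in> K ar B \<and>
     (\<exists>\<beta>\<in>K ar B. rho ar B (cjoin ar B \<alpha> \<beta>) = rho ar B (Nabla B) \<and>
                  rho ar B (comm ar B \<alpha> \<beta>) = rho ar B (Delta B))"

text \<open>lambda_B maps B(Con(B)) onto B(L(B)): every Boolean class [alpha] of L(B)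
  equals lambda_B(gamma) = [gamma] for some gamma in B(Con(B)).\<close>
definition ret_preserves_bc :: "('f \<Rightarrow> nat) \<Rightarrow> ('f, 'a) alg \<Rightarrow> bool" where
  "ret_preserves_bc ar B \<longleftrightarrow>
     (\<forall>\<alpha>. ret_boolean ar B \<alpha> \<longrightarrow>
        (\<exists>\<gamma>\<in>BCon ar B. \<gamma> \<in> K ar B \<and> rho ar B \<gamma> = rho ar B \<alpha>))"

definition quot_alg :: "('f, 'a) alg \<Rightarrow> ('a \<times> 'a) set \<Rightarrow> ('f, 'a set) alg" where
  "quot_alg A \<theta> = \<lparr> carr = carr A // \<theta>,
     ops = (\<lambda>f Xs. \<theta> `` {ops A f (map (\<lambda>X. SOME x. x \<in> X) Xs)}) \<rparr>"

definition quot_con :: "('a \<times> 'a) set \<Rightarrow> ('a \<times> 'a) set \<Rightarrow> ('a set \<times> 'a set) set" where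
  "quot_con \<theta> \<alpha> = {(\<theta> `` {x}, \<theta> `` {y}) | x y. (x, y) \<in> \<alpha>}"

definition CBLP :: "('f \<Rightarrow> nat) \<Rightarrow> ('f, 'a) alg \<Rightarrow> ('a \<times> 'a) set \<Rightarrow> bool" where
  "CBLP ar A \<theta> \<longleftrightarrow>
     (\<forall>\<beta>\<in>BCon ar (quot_alg A \<theta>). \<exists>\<alpha>\<in>BCon ar A. quot_con \<theta> (cjoin ar A \<alpha> \<theta>) = \<beta>)"

definition modular_con :: "('f \<Rightarrow> nat) \<Rightarrow> ('f, 'a) alg \<Rightarrow> bool" where
  "modular_con ar B \<longleftrightarrow> (\<forall>\<alpha>\<in>Con ar B. \<forall>\<beta>\<in>Con ar B. \<forall>\<gamma>\<in>Con ar B.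
     \<alpha> \<subseteq> \<gamma> \<longrightarrow> cjoin ar B \<alpha> (\<beta> \<inter> \<gamma>) = cjoin ar B \<alpha> \<beta> \<inter> \<gamma>)"

definition one_elem_subalg :: "('f \<Rightarrow> nat) \<Rightarrow> ('f, 'a) alg \<Rightarrow> bool" where
  "one_elem_subalg ar B \<longleftrightarrow> (\<exists>x\<in>carr B. \<forall>f. ops B f (replicate (ar f) x) = x)"

definition nontrivial :: "('f, 'a) alg \<Rightarrow> bool" where
  "nontrivial B \<longleftrightarrow> (\<exists>x\<in>carr B. \<exists>y\<in>carr B. x \<noteq> y)"

end

theory Submission
  imports Defs
begin

text \<open>
  The key fact is that comaximal congruences \<alpha>, \<beta> with \<alpha> \<inter> \<beta> \<subseteq> \<chi> satisfy (\<alpha> \<or> \<chi>) \<inter> (\<beta> \<or> \<chi>) = \<chi>.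
  Let \<psi> be the left-hand side. The shifting lemma, applied to subalgebras of A \<times> A and A \<times> A \<times> A, yields
  congruences of the algebra \<psi> \<subseteq> A \<times> A that identify (x, x) with (y, y) for (x, y) in \<alpha>, respectively in \<beta>,
  and under which \<chi> \<subseteq> \<psi> is saturated. Their join collapses the diagonal, which becomes a one-element
  subalgebra of the quotient; by semidegeneracy the join is everything, so \<psi> \<subseteq> \<chi>.

  Semidegeneracy and the finite signature also put every proper congruence below a maximal one.
  If now \<phi>/\<theta> and \<phi>'/\<theta> are complements in Con(A/\<theta>), then (\<phi> \<or> \<chi>)/\<chi> is complemented, hence
  \<phi> \<or> \<chi> = \<gamma> \<or> \<chi> for some \<gamma> with complement \<gamma>'. A maximal congruence above \<theta> contains \<chi>, so it contains
  \<phi> iff it contains \<gamma>. Therefore \<phi>' \<or> \<gamma> \<or> \<theta> = \<nabla> and \<gamma>' \<or> \<phi> = \<nabla>, and the key fact turns these into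
  \<phi> \<subseteq> \<gamma> \<or> \<theta> and \<gamma> \<subseteq> \<phi>.
\<close>

section \<open>Congruences\<close>

lemma ConI:
  assumes "\<theta> \<subseteq> carr B \<times> carr B"
    and "\<And>x. x \<in> carr B \<Longrightarrow> (x, x) \<in> \<theta>"
    and "\<And>x y. (x, y) \<in> \<theta> \<Longrightarrow> (y, x) \<in> \<theta>"
    and "\<And>x y z. (x, y) \<in> \<theta> \<Longrightarrow> (y, z) \<in> \<theta> \<Longrightarrow> (x, z) \<in> \<theta>"
    and "\<And>f xs ys. length xs = ar f \<Longrightarrow> length ys = ar f \<Longrightarrow>
           list_all2 (\<lambda>x y. (x, y) \<in> \<theta>) xs ys \<Longrightarrow> (ops B f xs, ops B f ys) \<in> \<theta>"
  shows "\<theta> \<in> Con ar B"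
proof -
  have "refl_on (carr B) \<theta>" using assms(2) by (simp add: refl_on_def)
  moreover have "sym \<theta>" using assms(3) by (rule symI)
  moreover have "trans \<theta>" using assms(4) by (rule transI)
  ultimately have "equiv (carr B) \<theta>" using assms(1) by (simp add: equiv_def)
  then show ?thesis using assms(5) by (simp add: Con_def)
qed

lemma Con_carr: "\<theta> \<in> Con ar B \<Longrightarrow> (x, y) \<in> \<theta> \<Longrightarrow> x \<in> carr B \<and> y \<in> carr B"
  by (auto simp: Con_def equiv_def)

lemma Con_sub: "\<theta> \<in> Con ar B \<Longrightarrow> \<theta> \<subseteq> carr B \<times> carr B"
  by (auto simp: Con_def equiv_def)

lemma Con_refl: "\<theta> \<in> Con ar B \<Longrightarrow> x \<in> carr B \<Longrightarrow> (x, x) \<in> \<theta>"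
  by (auto simp: Con_def equiv_def refl_on_def)

lemma Con_sym: "\<theta> \<in> Con ar B \<Longrightarrow> (x, y) \<in> \<theta> \<Longrightarrow> (y, x) \<in> \<theta>"
  by (auto simp: Con_def equiv_def dest: symD)

lemma Con_trans: "\<theta> \<in> Con ar B \<Longrightarrow> (x, y) \<in> \<theta> \<Longrightarrow> (y, z) \<in> \<theta> \<Longrightarrow> (x, z) \<in> \<theta>"
  by (auto simp: Con_def equiv_def dest: transD)

lemma Con_ops:
  "\<theta> \<in> Con ar B \<Longrightarrow> length xs = ar f \<Longrightarrow> length ys = ar f \<Longrightarrow>
   list_all2 (\<lambda>x y. (x, y) \<in> \<theta>) xs ys \<Longrightarrow> (ops B f xs, ops B f ys) \<in> \<theta>"
  by (simp add: Con_def)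

lemma is_alg_ops: "is_alg ar B \<Longrightarrow> length xs = ar f \<Longrightarrow> set xs \<subseteq> carr B \<Longrightarrow> ops B f xs \<in> carr B"
  by (simp add: is_alg_def)

lemma list_all2_carr:
  assumes "\<theta> \<subseteq> carr B \<times> carr B" "list_all2 (\<lambda>x y. (x, y) \<in> \<theta>) xs ys"
  shows "set xs \<subseteq> carr B" "set ys \<subseteq> carr B"
  using assms(2,1) by (induction xs ys rule: list_all2_induct) auto

lemma Nabla_Con: "is_alg ar B \<Longrightarrow> Nabla B \<in> Con ar B"
proof (rule ConI)
  fix f xs ys
  assume "is_alg ar B" "length xs = ar f" "length ys = ar f"
    "list_all2 (\<lambda>x y. (x, y) \<in> Nabla B) xs ys"
  then show "(ops B f xs, ops B f ys) \<in> Nabla B"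
    using list_all2_carr[of "Nabla B" B xs ys] by (auto simp: Nabla_def intro!: is_alg_ops)
qed (auto simp: Nabla_def)

lemma Con_le_Nabla: "\<theta> \<in> Con ar B \<Longrightarrow> \<theta> \<subseteq> Nabla B"
  by (auto simp: Nabla_def dest: Con_carr)

lemma Inter_Con:
  assumes "S \<subseteq> Con ar B" "S \<noteq> {}"
  shows "\<Inter>S \<in> Con ar B"
proof (rule ConI)
  show "\<Inter>S \<subseteq> carr B \<times> carr B" using assms Con_sub by blast
  show "(x, x) \<in> \<Inter>S" if "x \<in> carr B" for x
    using assms(1) that by (auto intro: Con_refl)
  show "(y, x) \<in> \<Inter>S" if "(x, y) \<in> \<Inter>S" for x y
    by (rule InterI, rule Con_sym[of _ ar B]) (use assms(1) that in auto)
  show "(x, z) \<in> \<Inter>S" if "(x, y) \<in> \<Inter>S" "(y, z) \<in> \<Inter>S" for x y z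
    by (rule InterI, rule Con_trans[of _ ar B _ y]) (use assms(1) that in auto)
  fix f xs ys
  assume a: "length xs = ar f" "length ys = ar f" "list_all2 (\<lambda>x y. (x, y) \<in> \<Inter>S) xs ys"
  show "(ops B f xs, ops B f ys) \<in> \<Inter>S"
  proof
    fix \<theta> assume "\<theta> \<in> S"
    then have "list_all2 (\<lambda>x y. (x, y) \<in> \<theta>) xs ys"
      using a(3) by (auto elim!: list_all2_mono)
    then show "(ops B f xs, ops B f ys) \<in> \<theta>"
      using assms(1) a(1,2) \<open>\<theta> \<in> S\<close> by (intro Con_ops[of \<theta> ar B]) auto
  qed
qed

lemma Int_Con: "\<alpha> \<in> Con ar B \<Longrightarrow> \<beta> \<in> Con ar B \<Longrightarrow> \<alpha> \<inter> \<beta> \<in> Con ar B"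
  using Inter_Con[of "{\<alpha>, \<beta>}" ar B] by simp

lemma cjoin_upper: "\<alpha> \<subseteq> cjoin ar B \<alpha> \<beta>" "\<beta> \<subseteq> cjoin ar B \<alpha> \<beta>"
  by (auto simp: cjoin_def Cg_def)

lemma cjoin_least: "\<tau> \<in> Con ar B \<Longrightarrow> \<alpha> \<subseteq> \<tau> \<Longrightarrow> \<beta> \<subseteq> \<tau> \<Longrightarrow> cjoin ar B \<alpha> \<beta> \<subseteq> \<tau>"
  unfolding cjoin_def Cg_def by (rule Inter_lower) simp

lemma cjoin_Con:
  assumes "is_alg ar B" "\<alpha> \<in> Con ar B" "\<beta> \<in> Con ar B"
  shows "cjoin ar B \<alpha> \<beta> \<in> Con ar B"
  unfolding cjoin_def Cg_def
proof (rule Inter_Con)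
  \<comment> \<open>The total congruence keeps the family nonempty; an empty intersection would be
    the whole type.\<close>
  have "Nabla B \<in> {\<theta> \<in> Con ar B. \<alpha> \<union> \<beta> \<subseteq> \<theta>}"
    using assms by (simp add: Nabla_Con Con_le_Nabla)
  then show "{\<theta> \<in> Con ar B. \<alpha> \<union> \<beta> \<subseteq> \<theta>} \<noteq> {}" by blast
qed auto

section \<open>Joins of congruences as transitive closures\<close>

lemma list_all2_relpow_SucD:
  assumes "list_all2 (\<lambda>x y. (x, y) \<in> R ^^ Suc n) xs ys"
  shows "\<exists>zs. list_all2 (\<lambda>x y. (x, y) \<in> R ^^ n) xs zs \<and> list_all2 (\<lambda>x y. (x, y) \<in> R) zs ys"
  using assms
proof (induction xs ys rule: list_all2_induct)
  case Nil
  then show ?case by simp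
next
  case (Cons x xs y ys)
  then obtain zs z where "list_all2 (\<lambda>x y. (x, y) \<in> R ^^ n) xs zs"
    "list_all2 (\<lambda>x y. (x, y) \<in> R) zs ys" "(x, z) \<in> R ^^ n" "(z, y) \<in> R"
    by auto
  then show ?case by (intro exI[of _ "z # zs"]) simp
qed

lemma relpow_mono_refl:
  assumes "refl_on X R" "R \<subseteq> X \<times> X" "n > 0" "n \<le> m" "(x, y) \<in> R ^^ n"
  shows "(x, y) \<in> R ^^ m"
  using assms(4)
proof (induction m rule: dec_induct)
  case base
  show ?case by (rule assms)
next
  case (step m)
  \<comment> \<open>A path of positive length ends in \<open>X\<close>, where reflexivity allows one
    more trivial step; a path of length zero could sit outside \<open>X\<close>.\<close>
  have "m > 0" using step assms(3) by simp
  then have "y \<in> X" using step.IH assms(2) by (cases m) auto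
  then show ?case using step.IH assms(1) by (auto simp: refl_on_def)
qed

text \<open>The entries are linked by paths of different lengths. Reflexivity pads them all to the
  maximum, so that an operation can be applied to the whole list one step at a time.\<close>

lemma list_all2_trancl_relpow:
  assumes "refl_on X R" "R \<subseteq> X \<times> X" "list_all2 (\<lambda>x y. (x, y) \<in> R\<^sup>+) xs ys"
  shows "\<exists>n>0. list_all2 (\<lambda>x y. (x, y) \<in> R ^^ n) xs ys"
  using assms(3)
proof (induction xs ys rule: list_all2_induct)
  case Nil
  then show ?case by auto
next
  case (Cons x xs y ys)
  obtain n where n: "n > 0" "list_all2 (\<lambda>x y. (x, y) \<in> R ^^ n) xs ys" using Cons by auto
  obtain m where m: "m > 0" "(x, y) \<in> R ^^ m" using Cons(1) by (auto simp: trancl_power)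
  have "list_all2 (\<lambda>x y. (x, y) \<in> R ^^ (max m n)) xs ys"
    using n relpow_mono_refl[OF assms(1,2) n(1)] by (auto elim!: list_all2_mono)
  moreover have "(x, y) \<in> R ^^ (max m n)"
    using m relpow_mono_refl[OF assms(1,2) m(1)] by auto
  ultimately show ?case using n(1) by (intro exI[of _ "max m n"]) auto
qed

text \<open>Once all argument paths have a common length, applying the operation at each stage gives
  a path between the values. Symmetry is demanded of \<open>R\<^sup>+\<close> rather than of
  \<open>R\<close>, because a relational product of congruences need not be symmetric.\<close>

lemma trancl_Con:
  assumes sub: "R \<subseteq> carr B \<times> carr B" and refl: "refl_on (carr B) R" and sym: "sym (R\<^sup>+)"
    and ops: "\<And>f xs ys. length xs = ar f \<Longrightarrow> length ys = ar f \<Longrightarrow>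
           list_all2 (\<lambda>x y. (x, y) \<in> R) xs ys \<Longrightarrow> (ops B f xs, ops B f ys) \<in> R"
  shows "R\<^sup>+ \<in> Con ar B"
proof (rule ConI)
  show "R\<^sup>+ \<subseteq> carr B \<times> carr B" using sub by (rule trancl_subset_Sigma)
  show "(x, x) \<in> R\<^sup>+" if "x \<in> carr B" for x using refl that by (auto simp: refl_on_def)
  show "(y, x) \<in> R\<^sup>+" if "(x, y) \<in> R\<^sup>+" for x y using sym that by (rule symD)
  show "(x, z) \<in> R\<^sup>+" if "(x, y) \<in> R\<^sup>+" "(y, z) \<in> R\<^sup>+" for x y z using that by (rule trancl_trans)
  fix f xs ys
  assume len: "length xs = ar f" "length ys = ar f" and rel: "list_all2 (\<lambda>x y. (x, y) \<in> R\<^sup>+) xs ys"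
  have pow: "(ops B f xs, ops B f ys) \<in> R ^^ Suc n"
    if "length xs = ar f" "length ys = ar f" "list_all2 (\<lambda>x y. (x, y) \<in> R ^^ Suc n) xs ys" for n ys
    using that
  proof (induction n arbitrary: ys)
    case 0
    then show ?case using ops by simp
  next
    case (Suc n)
    obtain zs where zs: "list_all2 (\<lambda>x y. (x, y) \<in> R ^^ Suc n) xs zs" "list_all2 (\<lambda>x y. (x, y) \<in> R) zs ys"
      using list_all2_relpow_SucD[OF Suc.prems(3)] by blast
    have "length zs = ar f" using zs(1) Suc.prems(1) by (auto dest: list_all2_lengthD)
    then have "(ops B f xs, ops B f zs) \<in> R ^^ Suc n" "(ops B f zs, ops B f ys) \<in> R"
      using Suc zs ops by blast+
    then show ?case by (rule relpow_Suc_I)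
  qed
  obtain n where "n > 0" "list_all2 (\<lambda>x y. (x, y) \<in> R ^^ n) xs ys"
    using list_all2_trancl_relpow[OF refl sub rel] by blast
  then have "(ops B f xs, ops B f ys) \<in> R ^^ n" using pow[of ys "n - 1"] len by simp
  then show "(ops B f xs, ops B f ys) \<in> R\<^sup>+" using \<open>n > 0\<close> by (auto simp: trancl_power)
qed

lemma cjoin_eq_trancl:
  assumes \<alpha>: "\<alpha> \<in> Con ar B" and \<beta>: "\<beta> \<in> Con ar B"
  shows "cjoin ar B \<alpha> \<beta> = (\<alpha> O \<beta>)\<^sup>+"
proof
  have \<alpha>R: "\<alpha> \<subseteq> \<alpha> O \<beta>" by (auto dest: Con_carr[OF \<alpha>] intro!: Con_refl[OF \<beta>] relcompI)
  have \<beta>R: "\<beta> \<subseteq> \<alpha> O \<beta>" by (auto dest: Con_carr[OF \<beta>] intro!: relcompI[OF Con_refl[OF \<alpha>]])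
  have "(\<alpha> O \<beta>)\<^sup>+ \<in> Con ar B"
  proof (rule trancl_Con)
    show "\<alpha> O \<beta> \<subseteq> carr B \<times> carr B" using Con_carr[OF \<alpha>] Con_carr[OF \<beta>] by blast
    show "refl_on (carr B) (\<alpha> O \<beta>)"
      using Con_refl[OF \<alpha>] Con_refl[OF \<beta>] by (auto simp: refl_on_def)
    \<comment> \<open>Since \<open>\<beta> O \<alpha>\<close> need not lie in
      \<open>\<alpha> O \<beta>\<close>, a reversed step is replaced by two steps, each completed by
      reflexivity.\<close>
    have step: "(y, x) \<in> (\<alpha> O \<beta>)\<^sup>+" if xy: "(x, y) \<in> \<alpha> O \<beta>" for x y
    proof -
      obtain z where "(x, z) \<in> \<alpha>" "(z, y) \<in> \<beta>" using xy by blast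
      then have "(y, z) \<in> \<alpha> O \<beta>" "(z, x) \<in> \<alpha> O \<beta>"
        using \<alpha>R \<beta>R Con_sym[OF \<alpha>] Con_sym[OF \<beta>] by blast+
      then show ?thesis by auto
    qed
    show "sym ((\<alpha> O \<beta>)\<^sup>+)"
    proof (rule symI)
      fix x y assume "(x, y) \<in> (\<alpha> O \<beta>)\<^sup>+"
      then show "(y, x) \<in> (\<alpha> O \<beta>)\<^sup>+"
        by (induction rule: trancl_induct) (blast intro: step trancl_trans)+
    qed
    fix f xs ys
    assume len: "length xs = ar f" "length ys = ar f" and "list_all2 (\<lambda>x y. (x, y) \<in> \<alpha> O \<beta>) xs ys"
    from this(3) have "\<exists>zs. list_all2 (\<lambda>x y. (x, y) \<in> \<alpha>) xs zs \<and> list_all2 (\<lambda>x y. (x, y) \<in> \<beta>) zs ys"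
    proof (induction xs ys rule: list_all2_induct)
      case Nil
      then show ?case by simp
    next
      case (Cons x xs y ys)
      then obtain zs z where "list_all2 (\<lambda>x y. (x, y) \<in> \<alpha>) xs zs"
        "list_all2 (\<lambda>x y. (x, y) \<in> \<beta>) zs ys" "(x, z) \<in> \<alpha>" "(z, y) \<in> \<beta>"
        by auto
      then show ?case by (intro exI[of _ "z # zs"]) simp
    qed
    then obtain zs where zs: "list_all2 (\<lambda>x y. (x, y) \<in> \<alpha>) xs zs" "list_all2 (\<lambda>x y. (x, y) \<in> \<beta>) zs ys"
      by blast
    have "length zs = ar f" using zs(1) len by (auto dest: list_all2_lengthD)
    then show "(ops B f xs, ops B f ys) \<in> \<alpha> O \<beta>"
      using Con_ops[OF \<alpha> len(1) _ zs(1)] Con_ops[OF \<beta> _ len(2) zs(2)] by blast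
  qed
  then show "cjoin ar B \<alpha> \<beta> \<subseteq> (\<alpha> O \<beta>)\<^sup>+"
    using \<alpha>R \<beta>R by (intro cjoin_least) auto
  show "(\<alpha> O \<beta>)\<^sup>+ \<subseteq> cjoin ar B \<alpha> \<beta>"
  proof (rule subrelI)
    fix x y assume "(x, y) \<in> (\<alpha> O \<beta>)\<^sup>+"
    then have "(x, y) \<in> \<theta>" if "\<theta> \<in> Con ar B" "\<alpha> \<union> \<beta> \<subseteq> \<theta>" for \<theta>
    proof (induction rule: trancl_induct)
      case (base y)
      then show ?case using that Con_trans[OF that(1)] by blast
    next
      case (step y z)
      then show ?case using that Con_trans[OF that(1)] by blast
    qed
    then show "(x, y) \<in> cjoin ar B \<alpha> \<beta>" by (auto simp: cjoin_def Cg_def)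
  qed
qed

text \<open>The join links points by alternating chains, so whatever survives \<alpha>-steps and
  \<beta>-steps survives the join. Later \<open>P\<close> is relatedness to a fixed diagonal point,
  or membership in \<chi>.\<close>

lemma cjoin_induct [consumes 3, case_names left right]:
  assumes \<alpha>: "\<alpha> \<in> Con ar B" and \<beta>: "\<beta> \<in> Con ar B" and xy: "(x, y) \<in> cjoin ar B \<alpha> \<beta>"
    and "\<And>y z. P y \<Longrightarrow> (y, z) \<in> \<alpha> \<Longrightarrow> P z"
    and "\<And>y z. P y \<Longrightarrow> (y, z) \<in> \<beta> \<Longrightarrow> P z"
    and "P x"
  shows "P y"
  using xy[unfolded cjoin_eq_trancl[OF \<alpha> \<beta>]] assms(4-)
  by (induction rule: trancl_induct) blast+

section \<open>Homomorphisms, subdirect products and homomorphic images\<close>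

definition is_hom :: "('f \<Rightarrow> nat) \<Rightarrow> ('f, 'a) alg \<Rightarrow> ('f, 'b) alg \<Rightarrow> ('a \<Rightarrow> 'b) \<Rightarrow> bool" where
  "is_hom ar C D g \<longleftrightarrow> g ` carr C \<subseteq> carr D \<and>
     (\<forall>f xs. length xs = ar f \<and> set xs \<subseteq> carr C \<longrightarrow> g (ops C f xs) = ops D f (map g xs))"

definition pullback :: "('f, 'a) alg \<Rightarrow> ('a \<Rightarrow> 'b) \<Rightarrow> ('b \<times> 'b) set \<Rightarrow> ('a \<times> 'a) set" where
  "pullback C g \<theta> = {(x, y) \<in> carr C \<times> carr C. (g x, g y) \<in> \<theta>}"

lemma pullback_Con:
  assumes C: "is_alg ar C" and g: "is_hom ar C D g" and \<theta>: "\<theta> \<in> Con ar D"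
  shows "pullback C g \<theta> \<in> Con ar C"
proof (rule ConI)
  show "pullback C g \<theta> \<subseteq> carr C \<times> carr C" by (auto simp: pullback_def)
  show "(x, x) \<in> pullback C g \<theta>" if "x \<in> carr C" for x
    using that g Con_refl[OF \<theta>] by (auto simp: pullback_def is_hom_def)
  show "(y, x) \<in> pullback C g \<theta>" if "(x, y) \<in> pullback C g \<theta>" for x y
    using that Con_sym[OF \<theta>] by (auto simp: pullback_def)
  show "(x, z) \<in> pullback C g \<theta>" if "(x, y) \<in> pullback C g \<theta>" "(y, z) \<in> pullback C g \<theta>" for x y z
    using that Con_trans[OF \<theta>] by (auto simp: pullback_def)
  fix f xs ys
  assume len: "length xs = ar f" "length ys = ar f"
    and rel: "list_all2 (\<lambda>x y. (x, y) \<in> pullback C g \<theta>) xs ys"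
  have carr: "set xs \<subseteq> carr C" "set ys \<subseteq> carr C"
    using list_all2_carr[OF _ rel, of C] by (auto simp: pullback_def)
  have "list_all2 (\<lambda>x y. (x, y) \<in> \<theta>) (map g xs) (map g ys)"
    using rel by (auto simp: list_all2_map1 list_all2_map2 pullback_def elim!: list_all2_mono)
  then have "(ops D f (map g xs), ops D f (map g ys)) \<in> \<theta>"
    using Con_ops[OF \<theta>] len by simp
  then show "(ops C f xs, ops C f ys) \<in> pullback C g \<theta>"
    using g len carr is_alg_ops[OF C] by (auto simp: pullback_def is_hom_def)
qed

lemma eval_carr:
  assumes "is_alg ar C" "range s \<subseteq> carr C" "wf_trm ar t"
  shows "eval C s t \<in> carr C"
  using assms(3)
proof (induction t)
  case (Var v)
  then show ?case using assms(2) by auto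
next
  case (App f ts)
  then show ?case by (auto intro!: is_alg_ops[OF assms(1)])
qed

lemma eval_hom:
  assumes "is_alg ar C" "is_hom ar C D g" "range s \<subseteq> carr C" "wf_trm ar t"
  shows "g (eval C s t) = eval D (g \<circ> s) t"
  using assms(4)
proof (induction t)
  case (Var v)
  then show ?case by simp
next
  case (App f ts)
  have "set (map (eval C s) ts) \<subseteq> carr C" using App.prems eval_carr[OF assms(1,3)] by auto
  then have "g (ops C f (map (eval C s) ts)) = ops D f (map g (map (eval C s) ts))"
    using assms(2) App.prems by (auto simp: is_hom_def)
  also have "map g (map (eval C s) ts) = map (eval D (g \<circ> s)) ts"
    using App by (simp add: comp_def)
  finally show ?case by (simp add: comp_def)
qed

text \<open>\<open>S\<close> is an arbitrary set; its closure under the operations is stated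
  separately by \<open>is_alg\<close>. Taking a congruence for \<open>S\<close> turns that
  congruence into a subalgebra of A \<times> A.\<close>

definition sub_prod :: "('f, 'a) alg \<Rightarrow> ('f, 'b) alg \<Rightarrow> ('a \<times> 'b) set \<Rightarrow> ('f, 'a \<times> 'b) alg" where
  "sub_prod C D S = \<lparr> carr = S, ops = (\<lambda>f zs. (ops C f (map fst zs), ops D f (map snd zs))) \<rparr>"

lemma carr_sub_prod [simp]: "carr (sub_prod C D S) = S"
  by (simp add: sub_prod_def)

lemma ops_sub_prod [simp]: "ops (sub_prod C D S) f zs = (ops C f (map fst zs), ops D f (map snd zs))"
  by (simp add: sub_prod_def)

lemma eval_sub_prod: "eval (sub_prod C D S) s t = (eval C (fst \<circ> s) t, eval D (snd \<circ> s) t)"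
proof (induction t)
  case (Var v)
  then show ?case by simp
next
  case (App f ts)
  then have "map fst (map (eval (sub_prod C D S) s) ts) = map (eval C (fst \<circ> s)) ts"
    "map snd (map (eval (sub_prod C D S) s) ts) = map (eval D (snd \<circ> s)) ts"
    by (simp_all add: comp_def)
  then show ?case by (simp add: comp_def del: map_map)
qed

lemma in_var_sub_prod:
  assumes C: "in_var ar E C" and D: "in_var ar E D" and S: "S \<subseteq> carr C \<times> carr D"
    and alg: "is_alg ar (sub_prod C D S)"
  shows "in_var ar E (sub_prod C D S)"
  unfolding in_var_def
proof (intro conjI ballI, rule alg, clarify)
  fix s t and \<sigma> :: "nat \<Rightarrow> 'b \<times> 'c"
  assume st: "(s, t) \<in> E" and \<sigma>: "range \<sigma> \<subseteq> carr (sub_prod C D S)"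
  have \<sigma>n: "\<sigma> n \<in> carr C \<times> carr D" for n
    using subsetD[OF S subsetD[OF \<sigma>[unfolded carr_sub_prod] rangeI[of \<sigma> n]]] .
  have "range (fst \<circ> \<sigma>) \<subseteq> carr C" "range (snd \<circ> \<sigma>) \<subseteq> carr D"
    using \<sigma>n by (auto simp: mem_Times_iff)
  then have "eval C (fst \<circ> \<sigma>) s = eval C (fst \<circ> \<sigma>) t" "eval D (snd \<circ> \<sigma>) s = eval D (snd \<circ> \<sigma>) t"
    using C D st unfolding in_var_def by blast+
  then show "eval (sub_prod C D S) \<sigma> s = eval (sub_prod C D S) \<sigma> t"
    by (simp add: eval_sub_prod)
qed

lemma is_alg_Con_sub_prod:
  assumes "is_alg ar A" "\<sigma> \<in> Con ar A"
  shows "is_alg ar (sub_prod A A \<sigma>)"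
  unfolding is_alg_def
proof (intro conjI allI impI)
  show "carr (sub_prod A A \<sigma>) \<noteq> {}" using assms Con_refl by (fastforce simp: is_alg_def)
  fix f and zs :: "('b \<times> 'b) list"
  assume "length zs = ar f \<and> set zs \<subseteq> carr (sub_prod A A \<sigma>)"
  then show "ops (sub_prod A A \<sigma>) f zs \<in> carr (sub_prod A A \<sigma>)"
    using Con_ops[OF assms(2), of "map fst zs" f "map snd zs"]
    by (auto simp: list_all2_map1 list_all2_map2 list_all2_same)
qed

text \<open>This realizes the quotient of \<open>C\<close> by \<open>kernel C g\<close> inside the
  codomain type of \<open>g\<close>. The hypotheses on the variety speak of a single universe, so
  quotients and copies of algebras over other types have to be placed there. The choice of preimages
  is harmless when the kernel is a congruence.\<close>

definition image_alg :: "('a \<Rightarrow> 'b) \<Rightarrow> ('f, 'a) alg \<Rightarrow> ('f, 'b) alg" where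
  "image_alg g C = \<lparr> carr = g ` carr C, ops = (\<lambda>f zs. g (ops C f (map (inv_into (carr C) g) zs))) \<rparr>"

lemma carr_image_alg [simp]: "carr (image_alg g C) = g ` carr C"
  by (simp add: image_alg_def)

definition kernel :: "('f, 'a) alg \<Rightarrow> ('a \<Rightarrow> 'b) \<Rightarrow> ('a \<times> 'a) set" where
  "kernel C g = {(x, y) \<in> carr C \<times> carr C. g x = g y}"

lemma image_alg_hom:
  assumes ker: "kernel C g \<in> Con ar C"
  shows "is_hom ar C (image_alg g C) g"
  unfolding is_hom_def
proof (intro conjI allI impI)
  fix f xs assume xs: "length xs = ar f \<and> set xs \<subseteq> carr C"
  have "list_all2 (\<lambda>x y. (x, y) \<in> kernel C g) xs (map (inv_into (carr C) g \<circ> g) xs)"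
    using xs by (auto simp: list_all2_map2 list_all2_same kernel_def subset_iff
        intro!: inv_into_into f_inv_into_f[symmetric])
  from Con_ops[OF ker _ _ this, of f] have "g (ops C f xs) = g (ops C f (map (inv_into (carr C) g \<circ> g) xs))"
    using xs by (simp add: kernel_def)
  then show "g (ops C f xs) = ops (image_alg g C) f (map g xs)"
    by (simp add: image_alg_def)
qed simp

text \<open>An assignment into the image lifts to \<open>C\<close> through chosen preimages; the
  identity holds there, and \<open>g\<close> carries both sides back.\<close>

lemma in_var_image:
  assumes wf: "\<forall>(s, t)\<in>E. wf_trm ar s \<and> wf_trm ar t"
    and C: "in_var ar E C" and ker: "kernel C g \<in> Con ar C"
  shows "in_var ar E (image_alg g C)"
  unfolding in_var_def
proof (intro conjI ballI)
  have alg: "is_alg ar C" using C by (simp add: in_var_def)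
  note hom = image_alg_hom[OF ker]
  show "is_alg ar (image_alg g C)"
    unfolding is_alg_def
  proof (intro conjI allI impI)
    show "carr (image_alg g C) \<noteq> {}" using alg by (simp add: is_alg_def)
    fix f zs assume zs: "length zs = ar f \<and> set zs \<subseteq> carr (image_alg g C)"
    then have "ops C f (map (inv_into (carr C) g) zs) \<in> carr C"
      by (intro is_alg_ops[OF alg]) (auto intro: inv_into_into)
    then show "ops (image_alg g C) f zs \<in> carr (image_alg g C)" by (simp add: image_alg_def)
  qed
  fix p assume p: "p \<in> E"
  obtain s t where st: "p = (s, t)" by (cases p)
  have "eval (image_alg g C) \<sigma> s = eval (image_alg g C) \<sigma> t" if \<sigma>: "range \<sigma> \<subseteq> carr (image_alg g C)" for \<sigma>
  proof -
    define \<tau> where "\<tau> = inv_into (carr C) g \<circ> \<sigma>"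
    have \<tau>: "range \<tau> \<subseteq> carr C" "g \<circ> \<tau> = \<sigma>"
      using \<sigma> by (auto simp: \<tau>_def fun_eq_iff image_subset_iff intro!: inv_into_into f_inv_into_f)
    have "eval C \<tau> s = eval C \<tau> t" using C p st \<tau>(1) by (auto simp: in_var_def)
    then show ?thesis
      using eval_hom[OF alg hom \<tau>(1), of s] eval_hom[OF alg hom \<tau>(1), of t] wf p st \<tau>(2) by auto
  qed
  then show "case p of (s, t) \<Rightarrow> \<forall>\<sigma>. range \<sigma> \<subseteq> carr (image_alg g C) \<longrightarrow>
      eval (image_alg g C) \<sigma> s = eval (image_alg g C) \<sigma> t"
    using st by simp
qed

lemma kernel_Con:
  assumes C: "is_alg ar C" and D: "is_alg ar D" and g: "is_hom ar C D g"
  shows "kernel C g \<in> Con ar C"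
proof -
  have "Id_on (carr D) \<in> Con ar D"
  proof (rule ConI)
    fix f and xs ys
    assume "length xs = ar f" "list_all2 (\<lambda>x y. (x, y) \<in> Id_on (carr D)) xs ys"
    moreover from this(2) have "xs = ys \<and> set xs \<subseteq> carr D"
      by (induction xs ys rule: list_all2_induct) auto
    ultimately show "(ops D f xs, ops D f ys) \<in> Id_on (carr D)"
      using is_alg_ops[OF D] by auto
  qed auto
  moreover have "kernel C g = pullback C g (Id_on (carr D))"
    using g by (auto simp: kernel_def pullback_def is_hom_def)
  ultimately show ?thesis using pullback_Con[OF C g] by simp
qed

lemma is_hom_ops:
  "is_hom ar C D g \<Longrightarrow> length xs = ar f \<Longrightarrow> set xs \<subseteq> carr C \<Longrightarrow> g (ops C f xs) = ops D f (map g xs)"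
  by (simp add: is_hom_def)

lemma is_hom_fst:
  "S \<subseteq> carr C \<times> carr D \<Longrightarrow> is_hom ar (sub_prod C D S) C fst"
  by (auto simp: is_hom_def)

lemma is_hom_snd:
  "S \<subseteq> carr C \<times> carr D \<Longrightarrow> is_hom ar (sub_prod C D S) D snd"
  by (auto simp: is_hom_def)

section \<open>The shifting lemma from the modular law\<close>

lemma shifting_modular:
  assumes "is_alg ar B" "modular_con ar B"
    and p: "p \<in> Con ar B" and q: "q \<in> Con ar B" and \<gamma>: "\<gamma> \<in> Con ar B" and "p \<inter> q \<subseteq> \<gamma>"
    and "(x, y) \<in> p" "(u, z) \<in> p" "(x, u) \<in> q" "(y, z) \<in> q" "(u, z) \<in> \<gamma>"
  shows "(x, y) \<in> \<gamma>"
proof -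
  \<comment> \<open>This is the modular law for \<gamma> \<inter> p below p. The path from x through
    u and z to y puts (x, y) in the right-hand side, and both joinands on the left lie below
    \<gamma>.\<close>
  have "cjoin ar B (\<gamma> \<inter> p) (q \<inter> p) = cjoin ar B (\<gamma> \<inter> p) q \<inter> p"
    using assms(2) p q Int_Con[OF \<gamma> p] by (simp add: modular_con_def)
  moreover have "(x, y) \<in> cjoin ar B (\<gamma> \<inter> p) q"
  proof -
    have J: "cjoin ar B (\<gamma> \<inter> p) q \<in> Con ar B"
      using cjoin_Con[OF assms(1) Int_Con[OF \<gamma> p] q] .
    have "(x, u) \<in> cjoin ar B (\<gamma> \<inter> p) q" "(u, z) \<in> cjoin ar B (\<gamma> \<inter> p) q"
      "(z, y) \<in> cjoin ar B (\<gamma> \<inter> p) q"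
      using assms(8-11) Con_sym[OF q] cjoin_upper[of "\<gamma> \<inter> p" ar B q] cjoin_upper(2)[of q ar B "\<gamma> \<inter> p"]
      by blast+
    then show ?thesis using Con_trans[OF J] by blast
  qed
  ultimately have "(x, y) \<in> cjoin ar B (\<gamma> \<inter> p) (q \<inter> p)" using assms(7) by blast
  then show ?thesis using cjoin_least[OF \<gamma>, of "\<gamma> \<inter> p" "q \<inter> p"] assms(6) by blast
qed

section \<open>Congruence modular semidegenerate varieties\<close>

locale cm_semidegenerate =
  fixes ar :: "'f \<Rightarrow> nat"
    and E :: "(('f, nat) trm \<times> ('f, nat) trm) set"
    and code :: "'u \<times> 'u \<Rightarrow> 'u" \<comment> \<open>transports subalgebras of A \<times> A and A \<times> A \<times> A back to the universe 'u\<close>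
  assumes finite_signature: "finite (UNIV :: 'f set)"
    and wf_E: "\<forall>(s, t)\<in>E. wf_trm ar s \<and> wf_trm ar t"
    and inj_code: "inj code"
    and modular: "\<forall>B :: ('f, 'u) alg. in_var ar E B \<longrightarrow> modular_con ar B"
    and semidegenerate: "\<forall>B :: ('f, 'u) alg. in_var ar E B \<and> nontrivial B \<longrightarrow> \<not> one_elem_subalg ar B"
begin

text \<open>Modularity is assumed only over \<open>'u\<close>. The injection \<open>h\<close> makes
  an isomorphic copy \<open>B\<close> of \<open>C\<close> there, and congruences travel along its
  inverse \<open>k\<close>. This makes the shifting lemma available for algebras of pairs and
  triples.\<close>

lemma shifting:
  fixes C :: "('f, 'c) alg" and h :: "'c \<Rightarrow> 'u"
  assumes C: "in_var ar E C" and h: "inj h"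
    and p: "p \<in> Con ar C" and q: "q \<in> Con ar C" and \<gamma>: "\<gamma> \<in> Con ar C" and pq: "p \<inter> q \<subseteq> \<gamma>"
    and xyuz: "(x, y) \<in> p" "(u, z) \<in> p" "(x, u) \<in> q" "(y, z) \<in> q" "(u, z) \<in> \<gamma>"
  shows "(x, y) \<in> \<gamma>"
proof -
  define B where "B = image_alg h C"
  define k where "k = inv_into (carr C) h"
  have algC: "is_alg ar C" using C by (simp add: in_var_def)
  have kh: "k (h v) = v" if "v \<in> carr C" for v
    using h that by (simp add: k_def inj_on_subset)
  have "kernel C h = kernel C id" using h by (auto simp: kernel_def inj_eq)
  then have "kernel C h \<in> Con ar C"
    using kernel_Con[OF algC algC, of id] by (simp add: is_hom_def)
  then have B: "in_var ar E B" unfolding B_def by (rule in_var_image[OF wf_E C])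
  then have algB: "is_alg ar B" by (simp add: in_var_def)
  have hom: "is_hom ar B C k"
    unfolding is_hom_def
  proof (intro conjI allI impI)
    show "k ` carr B \<subseteq> carr C" using kh by (auto simp: B_def)
    fix f zs assume zs: "length zs = ar f \<and> set zs \<subseteq> carr B"
    then have "ops C f (map k zs) \<in> carr C"
      using kh by (intro is_alg_ops[OF algC]) (auto simp: B_def)
    then show "k (ops B f zs) = ops C f (map k zs)"
      using kh by (simp add: B_def image_alg_def k_def)
  qed
  have rel: "(h v, h w) \<in> pullback B k \<theta> \<longleftrightarrow> (v, w) \<in> \<theta>" if "v \<in> carr C" "w \<in> carr C" for v w \<theta>
    using that kh by (auto simp: pullback_def B_def)
  have carr: "x \<in> carr C" "y \<in> carr C" "u \<in> carr C" "z \<in> carr C"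
    using xyuz(1,2) Con_carr[OF p] by blast+
  have "(h x, h y) \<in> pullback B k \<gamma>"
  proof (rule shifting_modular[OF algB, where u = "h u" and z = "h z"])
    show "modular_con ar B" using modular B by blast
    show "pullback B k p \<in> Con ar B" "pullback B k q \<in> Con ar B" "pullback B k \<gamma> \<in> Con ar B"
      using pullback_Con[OF algB hom] p q \<gamma> by blast+
    show "pullback B k p \<inter> pullback B k q \<subseteq> pullback B k \<gamma>"
      using pq by (auto simp: pullback_def)
  qed (use xyuz carr rel in \<open>auto\<close>)
  then show ?thesis using rel carr by blast
qed

text \<open>By \<open>idem\<close> the class of x is a one-element subalgebra of the quotient by
  \<kappa>; semidegeneracy then makes the quotient trivial.\<close>

lemma Con_eq_Nabla_if_idempotent_class:
  fixes C :: "('f, 'c) alg" and h :: "'c \<Rightarrow> 'u"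
  assumes C: "in_var ar E C" and h: "inj h" and \<kappa>: "\<kappa> \<in> Con ar C"
    and x: "x \<in> carr C" and idem: "\<And>f. (ops C f (replicate (ar f) x), x) \<in> \<kappa>"
  shows "\<kappa> = Nabla C"
proof -
  \<comment> \<open>The code of a chosen representative names the class, so the image of
    \<open>g\<close> is a copy of the quotient inside \<open>'u\<close>.\<close>
  define g where "g y = h (SOME z. (y, z) \<in> \<kappa>)" for y
  have ex: "(y, SOME z. (y, z) \<in> \<kappa>) \<in> \<kappa>" if "y \<in> carr C" for y
    using Con_refl[OF \<kappa> that] by (rule someI)
  have g1: "(y, z) \<in> \<kappa>" if "y \<in> carr C" "z \<in> carr C" "g y = g z" for y z
  proof -
    have "(SOME v. (y, v) \<in> \<kappa>) = (SOME v. (z, v) \<in> \<kappa>)"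
      using that(3) h by (simp add: g_def inj_eq)
    then have "(z, SOME v. (y, v) \<in> \<kappa>) \<in> \<kappa>" using ex[OF that(2)] by simp
    then show ?thesis using ex[OF that(1)] Con_sym[OF \<kappa>] Con_trans[OF \<kappa>] by blast
  qed
  have g2: "g y = g z" if "(y, z) \<in> \<kappa>" for y z
  proof -
    have "(y, v) \<in> \<kappa> \<longleftrightarrow> (z, v) \<in> \<kappa>" for v
      using that Con_sym[OF \<kappa>] Con_trans[OF \<kappa>] by blast
    then show ?thesis by (simp add: g_def)
  qed
  have ker: "kernel C g = \<kappa>"
  proof
    show "kernel C g \<subseteq> \<kappa>" by (auto simp: kernel_def intro: g1)
    show "\<kappa> \<subseteq> kernel C g" by (auto simp: kernel_def dest: Con_carr[OF \<kappa>] g2)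
  qed
  define B where "B = image_alg g C"
  have B: "in_var ar E B" unfolding B_def using in_var_image[OF wf_E C, of g] ker \<kappa> by simp
  have hom: "is_hom ar C B g" unfolding B_def using image_alg_hom[of C g ar] ker \<kappa> by simp
  have "ops B f (replicate (ar f) (g x)) = g x" for f
  proof -
    have "g (ops C f (replicate (ar f) x)) = ops B f (map g (replicate (ar f) x))"
      by (rule is_hom_ops[OF hom]) (use x in auto)
    then show ?thesis using g2[OF idem[of f]] by (simp add: map_replicate)
  qed
  then have "one_elem_subalg ar B" using x by (auto simp: one_elem_subalg_def B_def)
  then have "\<not> nontrivial B" using semidegenerate B by blast
  then have "g y = g z" if "y \<in> carr C" "z \<in> carr C" for y z
    using that unfolding nontrivial_def B_def carr_image_alg by blast
  then have "Nabla C \<subseteq> \<kappa>" unfolding Nabla_def using g1 by blast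
  then show ?thesis using Con_le_Nabla[OF \<kappa>] by blast
qed

section \<open>Congruences on a congruence viewed as an algebra\<close>

context
  fixes A :: "('f, 'u) alg"
  assumes A: "in_var ar E A"
begin

lemma alg_A: "is_alg ar A"
  using A by (simp add: in_var_def)

lemma in_var_Con:
  assumes "\<sigma> \<in> Con ar A"
  shows "in_var ar E (sub_prod A A \<sigma>)"
  using in_var_sub_prod[OF A A Con_sub[OF assms] is_alg_Con_sub_prod[OF alg_A assms]] .

text \<open>This replaces the identity [\<sigma>, \<nabla>] = \<sigma> of commutator theory.\<close>
lemma diagonal_collapse:
  assumes \<sigma>: "\<sigma> \<in> Con ar A" and \<kappa>: "\<kappa> \<in> Con ar (sub_prod A A \<sigma>)"
    and diag: "\<And>x y. x \<in> carr A \<Longrightarrow> y \<in> carr A \<Longrightarrow> ((x, x), (y, y)) \<in> \<kappa>"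
  shows "\<kappa> = \<sigma> \<times> \<sigma>"
proof -
  obtain x where x: "x \<in> carr A" using alg_A by (auto simp: is_alg_def)
  have "\<kappa> = Nabla (sub_prod A A \<sigma>)"
  proof (rule Con_eq_Nabla_if_idempotent_class[OF in_var_Con[OF \<sigma>] inj_code \<kappa>])
    show "(x, x) \<in> carr (sub_prod A A \<sigma>)" using Con_refl[OF \<sigma> x] by simp
    fix f
    have "ops A f (replicate (ar f) x) \<in> carr A" using x by (intro is_alg_ops[OF alg_A]) auto
    then show "(ops (sub_prod A A \<sigma>) f (replicate (ar f) (x, x)), (x, x)) \<in> \<kappa>"
      using diag x by (simp add: map_replicate)
  qed
  then show ?thesis by (simp add: Nabla_def)
qed

text \<open>This is the shifting lemma for the rectangle (x, z), (x, w), (y, z), (y, w), whose sides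
  lie in the kernels of the two projections; these meet in equality, hence inside every
  \<open>D\<close>. It supplies the meet condition when matrices are glued vertically.\<close>

lemma Con_shift_first:
  assumes \<alpha>: "\<alpha> \<in> Con ar A" and D: "D \<in> Con ar (sub_prod A A \<alpha>)"
    and yz: "((y, z), (y, w)) \<in> D" and xy: "(x, y) \<in> \<alpha>"
  shows "((x, z), (x, w)) \<in> D"
proof -
  let ?P = "sub_prod A A \<alpha>"
  have P: "is_alg ar ?P" using in_var_Con[OF \<alpha>] by (simp add: in_var_def)
  have yzw: "(y, z) \<in> \<alpha>" "(y, w) \<in> \<alpha>" using Con_carr[OF D yz] by simp_all
  then have xzw: "(x, z) \<in> \<alpha>" "(x, w) \<in> \<alpha>" using Con_trans[OF \<alpha> xy] by blast+
  show ?thesis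
  proof (rule shifting[OF in_var_Con[OF \<alpha>] inj_code _ _ D])
    show "kernel ?P fst \<in> Con ar ?P" by (rule kernel_Con[OF P alg_A is_hom_fst[OF Con_sub[OF \<alpha>]]])
    show "kernel ?P snd \<in> Con ar ?P" by (rule kernel_Con[OF P alg_A is_hom_snd[OF Con_sub[OF \<alpha>]]])
    show "kernel ?P fst \<inter> kernel ?P snd \<subseteq> D"
      using Con_refl[OF D] by (auto simp: kernel_def)
    show "((y, z), (y, w)) \<in> D" by (rule yz)
  qed (use yzw xzw in \<open>auto simp: kernel_def\<close>)
qed

text \<open>Read a pair ((a, c), (b, d)) of D as the matrix with columns (a, c) and (b, d). Transitivity of D
  glues matrices side by side; here they are glued on top of each other. The proof applies the shifting
  lemma to the algebra of triples x \<alpha> y \<alpha> z.\<close>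
lemma Con_vertical_trans:
  assumes \<alpha>: "\<alpha> \<in> Con ar A" and D: "D \<in> Con ar (sub_prod A A \<alpha>)"
    and cd: "((c, c), (d, d)) \<in> D"
    and ac: "((a, c), (b, d)) \<in> D" and ce: "((c, e), (d, f)) \<in> D"
  shows "((a, e), (b, f)) \<in> D"
proof -
  define S where "S = {(x, (y, z)). (x, y) \<in> \<alpha> \<and> (y, z) \<in> \<alpha>}"
  let ?P = "sub_prod A A \<alpha>"
  let ?T = "sub_prod A ?P S"
  have P: "is_alg ar ?P" using in_var_Con[OF \<alpha>] by (simp add: in_var_def)
  have S: "S \<subseteq> carr A \<times> carr ?P" using Con_carr[OF \<alpha>] by (auto simp: S_def)
  have T: "is_alg ar ?T"
    unfolding is_alg_def
  proof (intro conjI allI impI)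
    obtain x where "x \<in> carr A" using alg_A by (auto simp: is_alg_def)
    then have "(x, (x, x)) \<in> S" using Con_refl[OF \<alpha>] by (simp add: S_def)
    then show "carr ?T \<noteq> {}" by auto
    fix f and zs :: "('u \<times> 'u \<times> 'u) list"
    assume zs: "length zs = ar f \<and> set zs \<subseteq> carr ?T"
    have "z \<in> S" if "z \<in> set zs" for z using zs that by auto
    then have "(ops A f (map fst zs), ops A f (map fst (map snd zs))) \<in> \<alpha>"
      "(ops A f (map fst (map snd zs)), ops A f (map snd (map snd zs))) \<in> \<alpha>"
      using zs by (auto intro!: Con_ops[OF \<alpha>] simp: list_all2_map1 list_all2_map2 list_all2_same S_def)
    then show "ops ?T f zs \<in> carr ?T" by (simp add: S_def)
  qed
  have T': "in_var ar E ?T" using in_var_sub_prod[OF A in_var_Con[OF \<alpha>] S T] .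
  have inj: "inj (\<lambda>(x, p). code (x, code p))"
    by (auto intro!: injI dest!: injD[OF inj_code])
  let ?p12 = "\<lambda>(x, (y, z)). (x, y)" and ?p13 = "\<lambda>(x, (y, z)). (x, z)"
  have ST: "(x, z) \<in> \<alpha>" if "(x, (y, z)) \<in> S" for x y z
    using that Con_trans[OF \<alpha>] by (auto simp: S_def)
  have hom12: "is_hom ar ?T ?P ?p12"
    by (auto simp: is_hom_def S_def case_prod_unfold comp_def)
  have hom13: "is_hom ar ?T ?P ?p13"
    using ST by (auto simp: is_hom_def case_prod_unfold comp_def)
  have hom23: "is_hom ar ?T ?P snd" by (rule is_hom_snd[OF S])
  \<comment> \<open>A triple is a column of the glued matrix; two triples are related when the upper
    and the lower matrix both belong to \<open>D\<close>.\<close>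
  let ?\<Theta> = "pullback ?T ?p12 D \<inter> pullback ?T snd D"
  have mem: "(a, c) \<in> \<alpha>" "(b, d) \<in> \<alpha>" "(c, e) \<in> \<alpha>" "(d, f) \<in> \<alpha>" "(c, c) \<in> \<alpha>" "(d, d) \<in> \<alpha>"
    using Con_carr[OF D ac] Con_carr[OF D ce] Con_carr[OF D cd] by simp_all
  \<comment> \<open>The shift starts from the degenerate triples (a, c, c) and (b, d, d):
    \<open>ac\<close> and \<open>cd\<close> relate them, and omitting the middle entry leaves
    \<open>ac\<close>. Their last entries are then replaced by e and f, with the first two entries
    fixed.\<close>
  have "((a, (c, e)), (b, (d, f))) \<in> pullback ?T ?p13 D"
  proof (rule shifting[OF T' inj])
    show "?\<Theta> \<in> Con ar ?T" using pullback_Con[OF T hom12 D] pullback_Con[OF T hom23 D] by (rule Int_Con)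
    show "kernel ?T ?p12 \<in> Con ar ?T" by (rule kernel_Con[OF T P hom12])
    show "pullback ?T ?p13 D \<in> Con ar ?T" by (rule pullback_Con[OF T hom13 D])
    show "?\<Theta> \<inter> kernel ?T ?p12 \<subseteq> pullback ?T ?p13 D"
      using Con_shift_first[OF \<alpha> D] by (auto simp: pullback_def kernel_def S_def)
    show "((a, (c, c)), (b, (d, d))) \<in> ?\<Theta>" using mem ac cd by (auto simp: pullback_def S_def)
    show "((a, (c, c)), (b, (d, d))) \<in> pullback ?T ?p13 D" using mem ac by (auto simp: pullback_def S_def)
  qed (use mem ac ce in \<open>auto simp: pullback_def kernel_def S_def\<close>)
  then show ?thesis by (simp add: pullback_def)
qed

text \<open>Exchanging rows and columns turns a congruence on \<alpha> into one on \<psi>.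
  Reflexivity comes from \<open>diag\<close> and symmetry from \<open>flip\<close>; transitivity is
  vertical gluing, for which \<open>diag\<close> supplies the degenerate matrix on the common
  row.\<close>

lemma transposed_Con:
  assumes \<alpha>: "\<alpha> \<in> Con ar A" and \<psi>: "\<psi> \<in> Con ar A" and D: "D \<in> Con ar (sub_prod A A \<alpha>)"
    and diag: "\<And>x y. (x, y) \<in> \<psi> \<Longrightarrow> ((x, x), (y, y)) \<in> D"
    and flip: "\<And>a b c d. ((a, c), (b, d)) \<in> D \<Longrightarrow> ((c, a), (d, b)) \<in> D"
  shows "{((a, b), (c, d)). (a, b) \<in> \<psi> \<and> (c, d) \<in> \<psi> \<and> ((a, c), (b, d)) \<in> D} \<in> Con ar (sub_prod A A \<psi>)"
    (is "?\<Gamma> \<in> _")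
proof (rule ConI)
  show "?\<Gamma> \<subseteq> carr (sub_prod A A \<psi>) \<times> carr (sub_prod A A \<psi>)" by auto
  show "(p, p) \<in> ?\<Gamma>" if "p \<in> carr (sub_prod A A \<psi>)" for p
    using that diag by (cases p) auto
  show "(q, p) \<in> ?\<Gamma>" if "(p, q) \<in> ?\<Gamma>" for p q
    using that flip by auto
  show "(p, r) \<in> ?\<Gamma>" if "(p, q) \<in> ?\<Gamma>" "(q, r) \<in> ?\<Gamma>" for p q r
  proof -
    obtain a b c d e f where pqr: "p = (a, b)" "q = (c, d)" "r = (e, f)" by (cases p; cases q; cases r)
    then have "((c, c), (d, d)) \<in> D" "((a, c), (b, d)) \<in> D" "((c, e), (d, f)) \<in> D"
      using that diag by simp_all
    then have "((a, e), (b, f)) \<in> D" by (rule Con_vertical_trans[OF \<alpha> D])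
    then show ?thesis using that pqr by simp
  qed
  fix f and zs ws :: "('u \<times> 'u) list"
  assume len: "length zs = ar f" "length ws = ar f" and rel: "list_all2 (\<lambda>x y. (x, y) \<in> ?\<Gamma>) zs ws"
  \<comment> \<open>Regrouping the entries by columns turns lists related by the transposed relation
    into lists related by \<open>D\<close>.\<close>
  let ?ps = "zip (map fst zs) (map fst ws)" and ?qs = "zip (map snd zs) (map snd ws)"
  have nth: "(zs ! i, ws ! i) \<in> ?\<Gamma>" if "i < ar f" for i
    using rel len that by (simp add: list_all2_conv_all_nth)
  have "list_all2 (\<lambda>x y. (x, y) \<in> D) ?ps ?qs"
    using nth len by (fastforce simp: list_all2_conv_all_nth)
  from Con_ops[OF D _ _ this, of f] len
  have 1: "((ops A f (map fst zs), ops A f (map fst ws)), (ops A f (map snd zs), ops A f (map snd ws))) \<in> D"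
    by simp
  have "list_all2 (\<lambda>x y. (x, y) \<in> \<psi>) (map fst zs) (map snd zs)"
    "list_all2 (\<lambda>x y. (x, y) \<in> \<psi>) (map fst ws) (map snd ws)"
    using nth len by (fastforce simp: list_all2_conv_all_nth)+
  then have "(ops A f (map fst zs), ops A f (map snd zs)) \<in> \<psi>"
    "(ops A f (map fst ws), ops A f (map snd ws)) \<in> \<psi>"
    using len by (auto intro!: Con_ops[OF \<psi>])
  then show "(ops (sub_prod A A \<psi>) f zs, ops (sub_prod A A \<psi>) f ws) \<in> ?\<Gamma>"
    using 1 by simp
qed

text \<open>The term condition for [\<alpha>, \<psi>] \<subseteq> \<chi>. With the roles of \<alpha> and \<psi> exchanged it is the fact
  \<open>respects\<close> of the proof, which is additive in \<psi> \<subseteq> \<chi> \<or> \<beta>; transposing the matrices gives the version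
  that is needed here.\<close>
lemma centralizing_Con:
  assumes \<alpha>: "\<alpha> \<in> Con ar A" and \<beta>: "\<beta> \<in> Con ar A" and \<chi>: "\<chi> \<in> Con ar A" and \<psi>: "\<psi> \<in> Con ar A"
    and meet: "\<alpha> \<inter> \<beta> \<subseteq> \<chi>" and le: "\<psi> \<subseteq> cjoin ar A \<chi> \<beta>"
  obtains \<Gamma> where "\<Gamma> \<in> Con ar (sub_prod A A \<psi>)"
    and "\<And>x y. (x, y) \<in> \<alpha> \<Longrightarrow> ((x, x), (y, y)) \<in> \<Gamma>"
    and "\<And>a b c d. ((a, b), (c, d)) \<in> \<Gamma> \<Longrightarrow> (a, b) \<in> \<chi> \<Longrightarrow> (c, d) \<in> \<chi>"
proof -
  let ?P = "sub_prod A A \<alpha>" and ?Q = "sub_prod A A \<psi>"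
  have P: "is_alg ar ?P" using in_var_Con[OF \<alpha>] by (simp add: in_var_def)
  have Q: "is_alg ar ?Q" using in_var_Con[OF \<psi>] by (simp add: in_var_def)
  \<comment> \<open>\<open>sq \<theta>\<close> consists of the matrices with columns in \<alpha> and
    rows in \<theta>.\<close>
  define sq where "sq \<theta> = pullback ?P fst \<theta> \<inter> pullback ?P snd \<theta>" for \<theta>
  have sq_iff: "((a, c), (b, d)) \<in> sq \<theta> \<longleftrightarrow> (a, c) \<in> \<alpha> \<and> (b, d) \<in> \<alpha> \<and> (a, b) \<in> \<theta> \<and> (c, d) \<in> \<theta>" for a b c d \<theta>
    by (auto simp: sq_def pullback_def)
  have sq: "sq \<theta> \<in> Con ar ?P" if "\<theta> \<in> Con ar A" for \<theta>
    unfolding sq_def using that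
    by (intro Int_Con pullback_Con[OF P is_hom_fst[OF Con_sub[OF \<alpha>]]]
        pullback_Con[OF P is_hom_snd[OF Con_sub[OF \<alpha>]]])
  define D where "D = cjoin ar ?P (sq \<chi>) (sq \<beta>)"
  have D: "D \<in> Con ar ?P" unfolding D_def by (rule cjoin_Con[OF P sq[OF \<chi>] sq[OF \<beta>]])
  have D_sq: "sq \<chi> \<subseteq> D" "sq \<beta> \<subseteq> D" unfolding D_def by (rule cjoin_upper)+
  \<comment> \<open>The chain of \<chi>- and \<beta>-steps from x to y is copied onto the
    diagonal.\<close>
  have diag: "((x, x), (y, y)) \<in> D" if "(x, y) \<in> \<psi>" for x y
  proof -
    have xy: "(x, y) \<in> cjoin ar A \<chi> \<beta>" using le that by blast
    have x: "x \<in> carr A" using Con_carr[OF \<psi> that] by simp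
    show ?thesis
      using \<chi> \<beta> xy
    proof (induction rule: cjoin_induct)
      case (left y z)
      have "((y, y), (z, z)) \<in> sq \<chi>" using left(2) Con_carr[OF \<chi>] Con_refl[OF \<alpha>] by (auto simp: sq_iff)
      then show ?case using left(1) D_sq Con_trans[OF D] by blast
    next
      case (right y z)
      have "((y, y), (z, z)) \<in> sq \<beta>" using right(2) Con_carr[OF \<beta>] Con_refl[OF \<alpha>] by (auto simp: sq_iff)
      then show ?case using right(1) D_sq Con_trans[OF D] by blast
    next
      show "((x, x), (x, x)) \<in> D" using Con_refl[OF D] Con_refl[OF \<alpha> x] by simp
    qed
  qed
  have flip': "(prod.swap p, prod.swap q) \<in> D" if pq: "(p, q) \<in> D" for p q
    using sq[OF \<chi>] sq[OF \<beta>] pq[unfolded D_def]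
  proof (induction rule: cjoin_induct)
    case (left y z)
    have "(prod.swap y, prod.swap z) \<in> sq \<chi>"
      using left(2) Con_sym[OF \<alpha>] by (cases y; cases z) (auto simp: sq_iff)
    then show ?case using left(1) D_sq Con_trans[OF D] by blast
  next
    case (right y z)
    have "(prod.swap y, prod.swap z) \<in> sq \<beta>"
      using right(2) Con_sym[OF \<alpha>] by (cases y; cases z) (auto simp: sq_iff)
    then show ?case using right(1) D_sq Con_trans[OF D] by blast
  next
    have "prod.swap p \<in> \<alpha>" using Con_carr[OF D pq] Con_sym[OF \<alpha>] by (cases p) auto
    then show "(prod.swap p, prod.swap p) \<in> D" using Con_refl[OF D] by simp
  qed
  have respects: "q \<in> \<chi>" if pq: "(p, q) \<in> D" and p: "p \<in> \<chi>" for p q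
    using sq[OF \<chi>] sq[OF \<beta>] pq[unfolded D_def]
  proof (induction rule: cjoin_induct)
    case (left y z)
    obtain a c b d where yz: "y = (a, c)" "z = (b, d)" by (cases y; cases z)
    then have "(b, a) \<in> \<chi>" "(c, d) \<in> \<chi>" "(a, c) \<in> \<chi>"
      using left Con_sym[OF \<chi>] by (auto simp: sq_iff)
    then show ?case using Con_trans[OF \<chi>] yz by blast
  next
    case (right y z)
    obtain a c b d where yz: "y = (a, c)" "z = (b, d)" by (cases y; cases z)
    then have "(b, d) \<in> \<alpha>" "(a, c) \<in> \<alpha>" "(b, a) \<in> \<beta>" "(d, c) \<in> \<beta>" "(a, c) \<in> \<chi>"
      using right Con_sym[OF \<beta>] by (auto simp: sq_iff)
    \<comment> \<open>A \<beta>-step is a rectangle with two sides in \<alpha> and two in \<beta>;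
      as \<alpha> \<inter> \<beta> lies below \<chi>, the shifting lemma in A carries \<chi> from
      one \<alpha>-side to the other.\<close>
    then have "(b, d) \<in> \<chi>"
      using shifting[OF A, of id, OF _ \<alpha> \<beta> \<chi> meet] by simp
    then show ?case using yz by simp
  qed (rule p)
  define \<Gamma> where "\<Gamma> = {((a, b), (c, d)). (a, b) \<in> \<psi> \<and> (c, d) \<in> \<psi> \<and> ((a, c), (b, d)) \<in> D}"
  have \<Gamma>: "\<Gamma> \<in> Con ar ?Q"
    unfolding \<Gamma>_def
  proof (rule transposed_Con[OF \<alpha> \<psi> D diag])
    fix a b c d assume "((a, c), (b, d)) \<in> D"
    then show "((c, a), (d, b)) \<in> D" using flip'[of "(a, c)" "(b, d)"] by simp
  qed
  show thesis
  proof (rule that[OF \<Gamma>])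
    show \<Gamma>_diag: "((x, x), (y, y)) \<in> \<Gamma>" if "(x, y) \<in> \<alpha>" for x y
      using that Con_refl[OF D, of "(x, y)"] Con_carr[OF \<alpha> that] Con_refl[OF \<psi>] by (auto simp: \<Gamma>_def)
    fix a b c d assume abcd: "((a, b), (c, d)) \<in> \<Gamma>" and ab: "(a, b) \<in> \<chi>"
    have mem: "(a, b) \<in> \<psi>" "(c, d) \<in> \<psi>" "((a, c), (b, d)) \<in> D" using abcd by (auto simp: \<Gamma>_def)
    have ac: "(a, c) \<in> \<alpha>" using Con_carr[OF D mem(3)] by simp
    have refl: "(a, a) \<in> \<psi>" "(c, c) \<in> \<psi>" using Con_refl[OF \<psi>] Con_carr[OF \<alpha> ac] by auto
    \<comment> \<open>A second shift, in the algebra \<psi>, moves the edge from (a, a) to (a, b)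
      along \<Gamma> to the edge from (c, c) to (c, d). For \<Gamma>-related pairs with equal first
      coordinates, \<open>respects\<close> starts from a trivial column, which gives the meet
      condition.\<close>
    have "((c, c), (c, d)) \<in> pullback ?Q snd \<chi>"
    proof (rule shifting[OF in_var_Con[OF \<psi>] inj_code])
      show "kernel ?Q fst \<in> Con ar ?Q" by (rule kernel_Con[OF Q alg_A is_hom_fst[OF Con_sub[OF \<psi>]]])
      show "\<Gamma> \<in> Con ar ?Q" by (rule \<Gamma>)
      show "pullback ?Q snd \<chi> \<in> Con ar ?Q" by (rule pullback_Con[OF Q is_hom_snd[OF Con_sub[OF \<psi>]] \<chi>])
      show "kernel ?Q fst \<inter> \<Gamma> \<subseteq> pullback ?Q snd \<chi>"
      proof (rule subsetI)
        fix p assume p: "p \<in> kernel ?Q fst \<inter> \<Gamma>"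
        then obtain x y z where xyz: "p = ((x, y), (x, z))" by (auto simp: kernel_def)
        then have D': "((x, x), (y, z)) \<in> D" and xy: "(x, y) \<in> \<psi>" "(x, z) \<in> \<psi>" using p by (auto simp: \<Gamma>_def)
        have "(x, x) \<in> \<chi>" using Con_refl[OF \<chi>] Con_carr[OF \<psi> xy(1)] by blast
        then show "p \<in> pullback ?Q snd \<chi>" using respects[OF D'] xy xyz by (simp add: pullback_def)
      qed
      show "((c, c), (a, a)) \<in> \<Gamma>" using \<Gamma>_diag Con_sym[OF \<alpha> ac] by blast
      show "((c, d), (a, b)) \<in> \<Gamma>" using Con_sym[OF \<Gamma> abcd] .
    qed (use mem refl ab in \<open>auto simp: kernel_def pullback_def\<close>)
    then show "(c, d) \<in> \<chi>" by (simp add: pullback_def)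
  qed
qed

text \<open>This transports complementary pairs to the quotient by \<chi>. When \<beta> and \<chi>
  also join to \<open>Nabla A\<close>, it acts as a cancellation law that yields \<alpha>
  \<subseteq> \<chi>.\<close>

lemma comaximal_distrib:
  assumes \<alpha>: "\<alpha> \<in> Con ar A" and \<beta>: "\<beta> \<in> Con ar A" and \<chi>: "\<chi> \<in> Con ar A"
    and meet: "\<alpha> \<inter> \<beta> \<subseteq> \<chi>" and join: "cjoin ar A \<alpha> \<beta> = Nabla A"
  shows "cjoin ar A \<alpha> \<chi> \<inter> cjoin ar A \<beta> \<chi> = \<chi>"
proof
  define \<psi> where "\<psi> = cjoin ar A \<alpha> \<chi> \<inter> cjoin ar A \<beta> \<chi>"
  have \<psi>: "\<psi> \<in> Con ar A"
    unfolding \<psi>_def by (intro Int_Con cjoin_Con alg_A \<alpha> \<beta> \<chi>)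
  \<comment> \<open>Both bounds are recorded because \<open>centralizing_Con\<close> is used twice,
    with \<alpha> and \<beta> exchanged.\<close>
  have le: "\<psi> \<subseteq> cjoin ar A \<chi> \<beta>" "\<psi> \<subseteq> cjoin ar A \<chi> \<alpha>"
    by (auto simp: \<psi>_def cjoin_def Un_commute)
  obtain G where G: "G \<in> Con ar (sub_prod A A \<psi>)" "\<And>x y. (x, y) \<in> \<alpha> \<Longrightarrow> ((x, x), (y, y)) \<in> G"
    "\<And>a b c d. ((a, b), (c, d)) \<in> G \<Longrightarrow> (a, b) \<in> \<chi> \<Longrightarrow> (c, d) \<in> \<chi>"
    by (rule centralizing_Con[OF \<alpha> \<beta> \<chi> \<psi> meet le(1)]) (rule that)
  obtain H where H: "H \<in> Con ar (sub_prod A A \<psi>)" "\<And>x y. (x, y) \<in> \<beta> \<Longrightarrow> ((x, x), (y, y)) \<in> H"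
    "\<And>a b c d. ((a, b), (c, d)) \<in> H \<Longrightarrow> (a, b) \<in> \<chi> \<Longrightarrow> (c, d) \<in> \<chi>"
    by (rule centralizing_Con[OF \<beta> \<alpha> \<chi> \<psi> _ le(2)]) (use meet that in blast)+
  have Q: "is_alg ar (sub_prod A A \<psi>)" using in_var_Con[OF \<psi>] by (simp add: in_var_def)
  let ?J = "cjoin ar (sub_prod A A \<psi>) G H"
  have J: "?J \<in> Con ar (sub_prod A A \<psi>)" by (rule cjoin_Con[OF Q G(1) H(1)])
  have "((x, x), (y, y)) \<in> ?J" if x: "x \<in> carr A" and y: "y \<in> carr A" for x y
  proof -
    have "(x, y) \<in> cjoin ar A \<alpha> \<beta>" using x y join by (simp add: Nabla_def)
    with \<alpha> \<beta> show ?thesis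
    proof (induction rule: cjoin_induct)
      case (left y z)
      have "((y, y), (z, z)) \<in> ?J" using G(2)[OF left(2)] cjoin_upper(1) by blast
      then show ?case using left(1) Con_trans[OF J] by blast
    next
      case (right y z)
      have "((y, y), (z, z)) \<in> ?J" using H(2)[OF right(2)] cjoin_upper(2) by blast
      then show ?case using right(1) Con_trans[OF J] by blast
    next
      show "((x, x), (x, x)) \<in> ?J" using Con_refl[OF J] Con_refl[OF \<psi> x] by simp
    qed
  qed
  then have full: "?J = \<psi> \<times> \<psi>" by (rule diagonal_collapse[OF \<psi> J])
  show "cjoin ar A \<alpha> \<chi> \<inter> cjoin ar A \<beta> \<chi> \<subseteq> \<chi>"
  proof (rule subrelI)
    fix c d assume "(c, d) \<in> cjoin ar A \<alpha> \<chi> \<inter> cjoin ar A \<beta> \<chi>"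
    then have cd: "(c, d) \<in> \<psi>" by (simp add: \<psi>_def)
    have c: "c \<in> carr A" using Con_carr[OF \<psi> cd] by blast
    \<comment> \<open>The trivial pair (c, c) belongs to \<chi>, and every step of \<open>G\<close>
      or \<open>H\<close> preserves membership in \<chi>.\<close>
    have "((c, c), (c, d)) \<in> ?J" using full cd Con_refl[OF \<psi> c] by simp
    with G(1) H(1) show "(c, d) \<in> \<chi>"
    proof (induction rule: cjoin_induct)
      case (left y z)
      then show ?case using G(3) by (cases y; cases z) blast
    next
      case (right y z)
      then show ?case using H(3) by (cases y; cases z) blast
    next
      show "(c, c) \<in> \<chi>" by (rule Con_refl[OF \<chi> c])
    qed
  qed
  show "\<chi> \<subseteq> cjoin ar A \<alpha> \<chi> \<inter> cjoin ar A \<beta> \<chi>"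
    using cjoin_upper(2) by blast
qed

end

end

section \<open>Existence of maximal congruences\<close>

lemma Union_chain_Con:
  assumes chain: "subset.chain (Con ar B) \<C>" and ne: "\<C> \<noteq> {}"
  shows "\<Union>\<C> \<in> Con ar B"
proof (rule ConI)
  have sub: "\<C> \<subseteq> Con ar B" using chain by (simp add: subset.chain_def)
  show "\<Union>\<C> \<subseteq> carr B \<times> carr B" using sub Con_sub by fast
  show "(x, x) \<in> \<Union>\<C>" if "x \<in> carr B" for x using sub ne that Con_refl by fast
  show "(y, x) \<in> \<Union>\<C>" if xy: "(x, y) \<in> \<Union>\<C>" for x y
  proof -
    obtain \<theta> where "\<theta> \<in> \<C>" "(x, y) \<in> \<theta>" using xy by blast
    then show ?thesis using sub Con_sym[of \<theta> ar B x y] by blast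
  qed
  show "(x, z) \<in> \<Union>\<C>" if "(x, y) \<in> \<Union>\<C>" "(y, z) \<in> \<Union>\<C>" for x y z
  proof -
    obtain \<theta> where "\<theta> \<in> \<C>" "{(x, y), (y, z)} \<subseteq> \<theta>"
      using finite_subset_Union_chain[OF _ _ ne chain, of "{(x, y), (y, z)}"] \<open>(x, y) \<in> _\<close> \<open>(y, z) \<in> _\<close>
      by auto
    then show ?thesis using sub Con_trans[of \<theta> ar B x y z] by blast
  qed
  fix f xs ys
  assume len: "length xs = ar f" "length ys = ar f" and rel: "list_all2 (\<lambda>x y. (x, y) \<in> \<Union>\<C>) xs ys"
  \<comment> \<open>An operation has finitely many arguments, so all the pairs lie in a single
    member of the chain.\<close>
  have "set (zip xs ys) \<subseteq> \<Union>\<C>" using rel by (auto simp: list_all2_iff)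
  then obtain \<theta> where \<theta>: "\<theta> \<in> \<C>" "set (zip xs ys) \<subseteq> \<theta>"
    using finite_subset_Union_chain[OF _ _ ne chain, of "set (zip xs ys)"] by auto
  then have "list_all2 (\<lambda>x y. (x, y) \<in> \<theta>) xs ys" using len by (auto simp: list_all2_iff)
  then have "(ops B f xs, ops B f ys) \<in> \<theta>"
    by (intro Con_ops[of \<theta> ar B] len) (use sub \<theta> in auto)
  then show "(ops B f xs, ops B f ys) \<in> \<Union>\<C>" using \<theta>(1) by blast
qed

text \<open>Zorn's lemma applies to the proper congruences above \<theta>: one pair per operation
  symbol is enough to force a congruence to be total, so unions of chains stay proper.\<close>

lemma (in cm_semidegenerate) ex_MaxCon:
  fixes A :: "('f, 'u) alg"
  assumes A: "in_var ar E A" and \<theta>: "\<theta> \<in> Con ar A" "\<theta> \<noteq> Nabla A"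
  obtains \<mu> where "\<mu> \<in> MaxCon ar A" "\<theta> \<subseteq> \<mu>"
proof -
  define \<A> where "\<A> = {\<tau> \<in> Con ar A. \<theta> \<subseteq> \<tau> \<and> \<tau> \<noteq> Nabla A}"
  obtain x where x: "x \<in> carr A" using A by (auto simp: in_var_def is_alg_def)
  have "\<exists>M\<in>\<A>. \<forall>X\<in>\<A>. M \<subseteq> X \<longrightarrow> X = M"
  proof (rule subset_Zorn_nonempty)
    show "\<A> \<noteq> {}" using \<theta> by (auto simp: \<A>_def)
    fix \<C> assume ne: "\<C> \<noteq> {}" and chain\<A>: "subset.chain \<A> \<C>"
    have chain: "subset.chain (Con ar A) \<C>" and sub: "\<C> \<subseteq> \<A>"
      using chain\<A> by (auto simp: subset.chain_def \<A>_def)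
    have "\<Union>\<C> \<noteq> Nabla A"
      \<comment> \<open>the finitely many pairs saying that the class of x is a subalgebra would lie in one member\<close>
    proof
      assume full: "\<Union>\<C> = Nabla A"
      let ?F = "range (\<lambda>f. (ops A f (replicate (ar f) x), x))"
      have "ops A f (replicate (ar f) x) \<in> carr A" for f
        using A x by (intro is_alg_ops[of ar A]) (auto simp: in_var_def)
      then have "?F \<subseteq> \<Union>\<C>" using x by (auto simp: full Nabla_def)
      moreover have "finite ?F" using finite_signature by simp
      ultimately obtain \<tau> where \<tau>: "\<tau> \<in> \<C>" "?F \<subseteq> \<tau>"
        using finite_subset_Union_chain[OF _ _ ne chain] by metis
      have "\<tau> = Nabla A"
        by (rule Con_eq_Nabla_if_idempotent_class[OF A, of id, OF _ _ x])
          (use \<tau> sub in \<open>auto simp: \<A>_def\<close>)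
      then show False using \<tau>(1) sub by (auto simp: \<A>_def)
    qed
    moreover have "\<theta> \<subseteq> \<Union>\<C>" using ne sub by (auto simp: \<A>_def)
    ultimately show "\<Union>\<C> \<in> \<A>" using Union_chain_Con[OF chain ne] by (simp add: \<A>_def)
  qed
  then obtain \<mu> where \<mu>: "\<mu> \<in> \<A>" "\<forall>X\<in>\<A>. \<mu> \<subseteq> X \<longrightarrow> X = \<mu>" by blast
  then have "\<mu> \<in> MaxCon ar A" by (auto simp: MaxCon_def \<A>_def)
  then show thesis using that \<mu>(1) by (simp add: \<A>_def)
qed

section \<open>Congruences of quotient algebras\<close>

lemma carr_quot: "carr (quot_alg A \<theta>) = (\<lambda>x. \<theta> `` {x}) ` carr A"
  by (auto simp: quot_alg_def quotient_def)

lemma quot_conI: "(x, y) \<in> \<phi> \<Longrightarrow> (\<theta> `` {x}, \<theta> `` {y}) \<in> quot_con \<theta> \<phi>"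
  by (auto simp: quot_con_def)

context
  fixes ar :: "'f \<Rightarrow> nat" and A :: "('f, 'a) alg" and \<theta> :: "('a \<times> 'a) set"
  assumes alg: "is_alg ar A" and \<theta>: "\<theta> \<in> Con ar A"
begin

lemma class_eq_iff: "x \<in> carr A \<Longrightarrow> y \<in> carr A \<Longrightarrow> \<theta> `` {x} = \<theta> `` {y} \<longleftrightarrow> (x, y) \<in> \<theta>"
  using \<theta> by (intro eq_equiv_class_iff) (auto simp: Con_def)

lemma some_class: "x \<in> carr A \<Longrightarrow> (x, SOME y. y \<in> \<theta> `` {x}) \<in> \<theta>"
  using someI[of "\<lambda>y. y \<in> \<theta> `` {x}" x] Con_refl[OF \<theta>] by simp

text \<open>The quotient operations use arbitrary representatives; compatibility of \<theta> makes
  the choice immaterial.\<close>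

lemma quot_hom: "is_hom ar A (quot_alg A \<theta>) (\<lambda>x. \<theta> `` {x})"
  unfolding is_hom_def
proof (intro conjI allI impI)
  show "(\<lambda>x. \<theta> `` {x}) ` carr A \<subseteq> carr (quot_alg A \<theta>)" by (simp add: carr_quot)
  fix f xs assume xs: "length xs = ar f \<and> set xs \<subseteq> carr A"
  let ?ys = "map (\<lambda>x. SOME y. y \<in> \<theta> `` {x}) xs"
  have "list_all2 (\<lambda>x y. (x, y) \<in> \<theta>) xs ?ys"
    unfolding list_all2_map2 list_all2_same using xs some_class by blast
  then have "(ops A f xs, ops A f ?ys) \<in> \<theta>"
    using xs by (intro Con_ops[OF \<theta>]) simp_all
  then have "\<theta> `` {ops A f xs} = \<theta> `` {ops A f ?ys}"
    using class_eq_iff Con_carr[OF \<theta>] by blast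
  then show "\<theta> `` {ops A f xs} = ops (quot_alg A \<theta>) f (map (\<lambda>x. \<theta> `` {x}) xs)"
    by (simp add: quot_alg_def comp_def)
qed

lemma list_class:
  assumes "set Xs \<subseteq> carr (quot_alg A \<theta>)"
  obtains xs where "set xs \<subseteq> carr A" "Xs = map (\<lambda>x. \<theta> `` {x}) xs"
proof -
  have "\<exists>xs. set xs \<subseteq> carr A \<and> Xs = map (\<lambda>x. \<theta> `` {x}) xs"
    using assms
  proof (induction Xs)
    case (Cons X Xs)
    then obtain xs x where "set xs \<subseteq> carr A" "Xs = map (\<lambda>x. \<theta> `` {x}) xs" "x \<in> carr A" "X = \<theta> `` {x}"
      by (auto simp: carr_quot)
    then show ?case by (intro exI[of _ "x # xs"]) simp
  qed simp
  then show thesis using that by blast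
qed

lemma is_alg_quot: "is_alg ar (quot_alg A \<theta>)"
  unfolding is_alg_def
proof (intro conjI allI impI)
  show "carr (quot_alg A \<theta>) \<noteq> {}" using alg by (simp add: carr_quot is_alg_def)
  fix f Xs assume Xs: "length Xs = ar f \<and> set Xs \<subseteq> carr (quot_alg A \<theta>)"
  then obtain xs where xs: "set xs \<subseteq> carr A" "Xs = map (\<lambda>x. \<theta> `` {x}) xs" using list_class by blast
  then have "ops (quot_alg A \<theta>) f Xs = \<theta> `` {ops A f xs}"
    using is_hom_ops[OF quot_hom, of xs f] Xs by simp
  moreover have "ops A f xs \<in> carr A" using xs Xs by (intro is_alg_ops[OF alg]) auto
  ultimately show "ops (quot_alg A \<theta>) f Xs \<in> carr (quot_alg A \<theta>)" by (simp add: carr_quot)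
qed

text \<open>\<open>quot_con\<close> asks for some related representatives; \<theta> \<subseteq>
  \<phi> makes all representatives equally good.\<close>

lemma quot_con_iff:
  assumes \<phi>: "\<phi> \<in> Con ar A" "\<theta> \<subseteq> \<phi>" and x: "x \<in> carr A" and y: "y \<in> carr A"
  shows "(\<theta> `` {x}, \<theta> `` {y}) \<in> quot_con \<theta> \<phi> \<longleftrightarrow> (x, y) \<in> \<phi>"
proof
  assume "(\<theta> `` {x}, \<theta> `` {y}) \<in> quot_con \<theta> \<phi>"
  then obtain u v where uv: "(u, v) \<in> \<phi>" "\<theta> `` {x} = \<theta> `` {u}" "\<theta> `` {y} = \<theta> `` {v}"
    by (auto simp: quot_con_def)
  then have "(x, u) \<in> \<theta>" "(y, v) \<in> \<theta>"
    using class_eq_iff x y Con_carr[OF \<phi>(1) uv(1)] by blast+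
  then have "(x, u) \<in> \<phi>" "(v, y) \<in> \<phi>" using \<phi>(2) Con_sym[OF \<phi>(1)] by blast+
  then show "(x, y) \<in> \<phi>" using uv(1) Con_trans[OF \<phi>(1)] by blast
qed (auto simp: quot_con_def)

lemma quot_con_carr: "\<phi> \<in> Con ar A \<Longrightarrow> quot_con \<theta> \<phi> \<subseteq> carr (quot_alg A \<theta>) \<times> carr (quot_alg A \<theta>)"
  by (auto simp: quot_con_def carr_quot dest: Con_carr)

lemma quot_con_Con:
  assumes \<phi>: "\<phi> \<in> Con ar A" "\<theta> \<subseteq> \<phi>"
  shows "quot_con \<theta> \<phi> \<in> Con ar (quot_alg A \<theta>)"
proof (rule ConI)
  note iff = quot_con_iff[OF \<phi>]
  show carr: "quot_con \<theta> \<phi> \<subseteq> carr (quot_alg A \<theta>) \<times> carr (quot_alg A \<theta>)"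
    by (rule quot_con_carr[OF \<phi>(1)])
  show "(X, X) \<in> quot_con \<theta> \<phi>" if "X \<in> carr (quot_alg A \<theta>)" for X
    using that by (auto simp: carr_quot iff Con_refl[OF \<phi>(1)])
  show "(Y, X) \<in> quot_con \<theta> \<phi>" if "(X, Y) \<in> quot_con \<theta> \<phi>" for X Y
    using that Con_sym[OF \<phi>(1)] unfolding quot_con_def by blast
  show "(X, Z) \<in> quot_con \<theta> \<phi>" if XY: "(X, Y) \<in> quot_con \<theta> \<phi>" and YZ: "(Y, Z) \<in> quot_con \<theta> \<phi>" for X Y Z
  proof -
    obtain x y z where xyz: "x \<in> carr A" "y \<in> carr A" "z \<in> carr A"
      and eq: "X = \<theta> `` {x}" "Y = \<theta> `` {y}" "Z = \<theta> `` {z}"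
      using subsetD[OF carr XY] subsetD[OF carr YZ] by (auto simp: carr_quot)
    have "(x, y) \<in> \<phi>" "(y, z) \<in> \<phi>" using XY YZ xyz unfolding eq by (simp_all add: iff)
    then have "(x, z) \<in> \<phi>" by (rule Con_trans[OF \<phi>(1)])
    then show ?thesis using xyz unfolding eq by (simp add: iff)
  qed
  fix f Xs Ys
  assume len: "length Xs = ar f" "length Ys = ar f" and rel: "list_all2 (\<lambda>x y. (x, y) \<in> quot_con \<theta> \<phi>) Xs Ys"
  obtain xs where xs: "set xs \<subseteq> carr A" "Xs = map (\<lambda>x. \<theta> `` {x}) xs"
    using list_class[OF list_all2_carr(1)[OF carr rel]] .
  obtain ys where ys: "set ys \<subseteq> carr A" "Ys = map (\<lambda>x. \<theta> `` {x}) ys"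
    using list_class[OF list_all2_carr(2)[OF carr rel]] .
  have "(xs ! i, ys ! i) \<in> \<phi>" if "i < ar f" for i
  proof -
    have "xs ! i \<in> carr A" "ys ! i \<in> carr A" using that len xs ys by (auto simp: subset_iff)
    moreover have "(\<theta> `` {xs ! i}, \<theta> `` {ys ! i}) \<in> quot_con \<theta> \<phi>"
      using rel that len xs(2) ys(2) by (auto simp: list_all2_conv_all_nth)
    ultimately show ?thesis by (simp add: iff)
  qed
  then have "list_all2 (\<lambda>x y. (x, y) \<in> \<phi>) xs ys"
    using len xs(2) ys(2) by (simp add: list_all2_conv_all_nth)
  then have "(ops A f xs, ops A f ys) \<in> \<phi>"
    using len xs(2) ys(2) by (intro Con_ops[OF \<phi>(1)]) simp_all
  then have "(\<theta> `` {ops A f xs}, \<theta> `` {ops A f ys}) \<in> quot_con \<theta> \<phi>"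
    unfolding quot_con_def by blast
  then show "(ops (quot_alg A \<theta>) f Xs, ops (quot_alg A \<theta>) f Ys) \<in> quot_con \<theta> \<phi>"
    using is_hom_ops[OF quot_hom, of xs f] is_hom_ops[OF quot_hom, of ys f] xs ys len by simp
qed

lemma BCon_quotI:
  assumes \<phi>: "\<phi> \<in> Con ar A" "\<theta> \<subseteq> \<phi>" and \<psi>: "\<psi> \<in> Con ar A" "\<theta> \<subseteq> \<psi>"
    and meet: "\<phi> \<inter> \<psi> = \<theta>" and join: "cjoin ar A \<phi> \<psi> = Nabla A"
  shows "quot_con \<theta> \<phi> \<in> BCon ar (quot_alg A \<theta>)"
proof -
  let ?Q = "quot_alg A \<theta>" and ?q = "\<lambda>x. \<theta> `` {x}"
  let ?J = "cjoin ar ?Q (quot_con \<theta> \<phi>) (quot_con \<theta> \<psi>)"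
  have "(X, Y) \<in> quot_con \<theta> \<phi> \<inter> quot_con \<theta> \<psi> \<longleftrightarrow> (X, Y) \<in> Delta ?Q" for X Y
  proof (cases "X \<in> carr ?Q \<and> Y \<in> carr ?Q")
    case True
    then obtain x y where "x \<in> carr A" "y \<in> carr A" "X = ?q x" "Y = ?q y"
      by (auto simp: carr_quot)
    then show ?thesis
      using quot_con_iff[OF \<phi>] quot_con_iff[OF \<psi>] class_eq_iff[of x y] meet
      by (auto simp: Delta_def carr_quot)
  next
    case False
    then show ?thesis using quot_con_carr[OF \<phi>(1)] by (auto simp: Delta_def)
  qed
  then have "quot_con \<theta> \<phi> \<inter> quot_con \<theta> \<psi> = Delta ?Q" by (intro set_eqI) (auto simp del: Int_iff)
  moreover have "?J = Nabla ?Q"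
  proof
    have J: "?J \<in> Con ar ?Q"
      by (intro cjoin_Con is_alg_quot quot_con_Con \<phi> \<psi>)
    then show "?J \<subseteq> Nabla ?Q" by (rule Con_le_Nabla)
    \<comment> \<open>Pulled back to A, the join contains \<phi> and \<psi>, hence every pair;
      surjectivity of the quotient map gives the rest.\<close>
    have "cjoin ar A \<phi> \<psi> \<subseteq> pullback A ?q ?J"
    proof (rule cjoin_least[OF pullback_Con[OF alg quot_hom J]])
      show "\<phi> \<subseteq> pullback A ?q ?J"
        by (auto simp: pullback_def dest: Con_carr[OF \<phi>(1)] intro!: subsetD[OF cjoin_upper(1)] quot_conI)
      show "\<psi> \<subseteq> pullback A ?q ?J"
        by (auto simp: pullback_def dest: Con_carr[OF \<psi>(1)] intro!: subsetD[OF cjoin_upper(2)] quot_conI)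
    qed
    then show "Nabla ?Q \<subseteq> ?J" unfolding join by (auto simp: Nabla_def carr_quot pullback_def)
  qed
  ultimately show ?thesis
    unfolding BCon_def using quot_con_Con[OF \<phi>] quot_con_Con[OF \<psi>] by blast
qed

lemma quot_con_pullback:
  assumes "\<beta> \<in> Con ar (quot_alg A \<theta>)"
  shows "quot_con \<theta> (pullback A (\<lambda>x. \<theta> `` {x}) \<beta>) = \<beta>"
proof
  show "quot_con \<theta> (pullback A (\<lambda>x. \<theta> `` {x}) \<beta>) \<subseteq> \<beta>"
    by (auto simp: quot_con_def pullback_def)
  show "\<beta> \<subseteq> quot_con \<theta> (pullback A (\<lambda>x. \<theta> `` {x}) \<beta>)"
  proof (rule subrelI)
    fix X Y assume XY: "(X, Y) \<in> \<beta>"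
    then obtain x y where "x \<in> carr A" "y \<in> carr A" "X = \<theta> `` {x}" "Y = \<theta> `` {y}"
      using Con_carr[OF assms XY] by (auto simp: carr_quot)
    then show "(X, Y) \<in> quot_con \<theta> (pullback A (\<lambda>x. \<theta> `` {x}) \<beta>)"
      using XY unfolding quot_con_def pullback_def by blast
  qed
qed

text \<open>The pulled-back complements meet in the preimage of equality, which is \<theta>. Their
  join is total because its image in the quotient contains both complements.\<close>

lemma BCon_quotE:
  assumes "\<beta> \<in> BCon ar (quot_alg A \<theta>)"
  obtains \<phi> \<psi> where "\<phi> \<in> Con ar A" "\<theta> \<subseteq> \<phi>" "\<psi> \<in> Con ar A" "\<theta> \<subseteq> \<psi>"
    "\<phi> \<inter> \<psi> = \<theta>" "cjoin ar A \<phi> \<psi> = Nabla A" "quot_con \<theta> \<phi> = \<beta>"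
proof -
  let ?Q = "quot_alg A \<theta>" and ?q = "\<lambda>x. \<theta> `` {x}"
  obtain \<beta>' where \<beta>: "\<beta> \<in> Con ar ?Q" and \<beta>': "\<beta>' \<in> Con ar ?Q"
    and meet: "\<beta> \<inter> \<beta>' = Delta ?Q" and join: "cjoin ar ?Q \<beta> \<beta>' = Nabla ?Q"
    using assms by (auto simp: BCon_def)
  define \<phi> \<psi> where "\<phi> = pullback A ?q \<beta>" and "\<psi> = pullback A ?q \<beta>'"
  have \<phi>: "\<phi> \<in> Con ar A" and \<psi>: "\<psi> \<in> Con ar A"
    unfolding \<phi>_def \<psi>_def by (rule pullback_Con[OF alg quot_hom], fact)+
  have "(x, y) \<in> \<phi> \<inter> \<psi> \<longleftrightarrow> (x, y) \<in> \<theta>" for x y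
  proof -
    have "(x, y) \<in> \<phi> \<inter> \<psi> \<longleftrightarrow> x \<in> carr A \<and> y \<in> carr A \<and> (?q x, ?q y) \<in> Delta ?Q"
      unfolding meet[symmetric] by (auto simp: \<phi>_def \<psi>_def pullback_def)
    also have "\<dots> \<longleftrightarrow> x \<in> carr A \<and> y \<in> carr A \<and> ?q x = ?q y"
      by (auto simp: Delta_def carr_quot)
    also have "\<dots> \<longleftrightarrow> (x, y) \<in> \<theta>" using class_eq_iff Con_carr[OF \<theta>] by blast
    finally show ?thesis .
  qed
  then have mt: "\<phi> \<inter> \<psi> = \<theta>" by (intro set_eqI) (auto simp del: Int_iff)
  have jn: "cjoin ar A \<phi> \<psi> = Nabla A"
  proof
    let ?J = "cjoin ar A \<phi> \<psi>"
    have J: "?J \<in> Con ar A" by (rule cjoin_Con[OF alg \<phi> \<psi>])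
    then show "?J \<subseteq> Nabla A" by (rule Con_le_Nabla)
    have \<theta>J: "\<theta> \<subseteq> ?J" using mt cjoin_upper(1)[of \<phi> ar A \<psi>] by blast
    have mono: "quot_con \<theta> \<phi> \<subseteq> quot_con \<theta> ?J" "quot_con \<theta> \<psi> \<subseteq> quot_con \<theta> ?J"
      using cjoin_upper[of \<phi> ar A \<psi>] cjoin_upper(2)[of \<psi> ar A \<phi>] unfolding quot_con_def by blast+
    then have "cjoin ar ?Q \<beta> \<beta>' \<subseteq> quot_con \<theta> ?J"
      using quot_con_pullback[OF \<beta>] quot_con_pullback[OF \<beta>']
      by (intro cjoin_least[OF quot_con_Con[OF J \<theta>J]]) (simp_all add: \<phi>_def \<psi>_def)
    then show "Nabla A \<subseteq> ?J"
      using quot_con_iff[OF J \<theta>J] unfolding join by (auto simp: Nabla_def carr_quot)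
  qed
  show thesis
    by (rule that[OF \<phi> _ \<psi> _ mt jn]) (use mt quot_con_pullback[OF \<beta>] in \<open>auto simp: \<phi>_def\<close>)
qed

lemma quot_con_inj:
  assumes \<phi>: "\<phi> \<in> Con ar A" "\<theta> \<subseteq> \<phi>" and \<psi>: "\<psi> \<in> Con ar A" "\<theta> \<subseteq> \<psi>"
    and eq: "quot_con \<theta> \<phi> = quot_con \<theta> \<psi>"
  shows "\<phi> = \<psi>"
proof -
  have "(x, y) \<in> \<phi> \<longleftrightarrow> (x, y) \<in> \<psi>" if "x \<in> carr A" "y \<in> carr A" for x y
    using quot_con_iff[OF \<phi> that] quot_con_iff[OF \<psi> that] eq by simp
  then show ?thesis using Con_sub[OF \<phi>(1)] Con_sub[OF \<psi>(1)] by blast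
qed

end

section \<open>Transfer of lifting from \<chi> to \<theta>\<close>

lemma (in cm_semidegenerate) CBLP_of_same_MaxCon:
  fixes A :: "('f, 'u) alg"
  assumes A: "in_var ar E A" and \<theta>: "\<theta> \<in> Con ar A" and \<chi>: "\<chi> \<in> Con ar A" and sub: "\<theta> \<subseteq> \<chi>"
    and max_eq: "{\<mu> \<in> MaxCon ar A. \<theta> \<subseteq> \<mu>} = {\<mu> \<in> MaxCon ar A. \<chi> \<subseteq> \<mu>}"
    and cblp: "CBLP ar A \<chi>"
  shows "CBLP ar A \<theta>"
  unfolding CBLP_def
proof
  have alg: "is_alg ar A" using A by (simp add: in_var_def)
  \<comment> \<open>A maximal congruence above \<tau> contains \<theta>, hence \<chi> by
    \<open>max_eq\<close>. Totality of \<tau> can therefore be tested on congruences above both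
    \<tau> and \<chi>.\<close>
  have max: "\<tau> = Nabla A"
    if \<tau>: "\<tau> \<in> Con ar A" "\<theta> \<subseteq> \<tau>"
      and full: "\<And>\<mu>. \<mu> \<in> Con ar A \<Longrightarrow> \<tau> \<subseteq> \<mu> \<Longrightarrow> \<chi> \<subseteq> \<mu> \<Longrightarrow> Nabla A \<subseteq> \<mu>" for \<tau>
  proof (rule ccontr)
    assume "\<tau> \<noteq> Nabla A"
    then obtain \<mu> where \<mu>: "\<mu> \<in> MaxCon ar A" "\<tau> \<subseteq> \<mu>" using ex_MaxCon[OF A \<tau>(1)] by blast
    then have "\<chi> \<subseteq> \<mu>" using max_eq \<tau>(2) by blast
    moreover have "\<mu> \<in> Con ar A" "\<mu> \<noteq> Nabla A" using \<mu>(1) by (simp_all add: MaxCon_def)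
    ultimately show False using full[of \<mu>] \<mu>(2) Con_le_Nabla by blast
  qed
  fix \<beta> assume "\<beta> \<in> BCon ar (quot_alg A \<theta>)"
  then obtain \<phi> \<psi> where \<phi>: "\<phi> \<in> Con ar A" "\<theta> \<subseteq> \<phi>" and \<psi>: "\<psi> \<in> Con ar A" "\<theta> \<subseteq> \<psi>"
    and meet: "\<phi> \<inter> \<psi> = \<theta>" and join: "cjoin ar A \<phi> \<psi> = Nabla A" and \<beta>: "quot_con \<theta> \<phi> = \<beta>"
    by (rule BCon_quotE[OF alg \<theta>])
  have \<phi>\<chi>: "cjoin ar A \<phi> \<chi> \<in> Con ar A" and \<psi>\<chi>: "cjoin ar A \<psi> \<chi> \<in> Con ar A"
    by (intro cjoin_Con alg \<phi> \<psi> \<chi>)+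
  have "quot_con \<chi> (cjoin ar A \<phi> \<chi>) \<in> BCon ar (quot_alg A \<chi>)"
  proof (rule BCon_quotI[OF alg \<chi> \<phi>\<chi> _ \<psi>\<chi>])
    show "cjoin ar A \<phi> \<chi> \<inter> cjoin ar A \<psi> \<chi> = \<chi>"
      using comaximal_distrib[OF A \<phi>(1) \<psi>(1) \<chi>] meet sub join by simp
    let ?J = "cjoin ar A (cjoin ar A \<phi> \<chi>) (cjoin ar A \<psi> \<chi>)"
    have J: "?J \<in> Con ar A" by (rule cjoin_Con[OF alg \<phi>\<chi> \<psi>\<chi>])
    have "\<phi> \<subseteq> ?J" using cjoin_upper(1) cjoin_upper(1) by (rule subset_trans)
    moreover have "\<psi> \<subseteq> ?J" using cjoin_upper(1) cjoin_upper(2) by (rule subset_trans)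
    ultimately show "?J = Nabla A" using cjoin_least[OF J, of \<phi> \<psi>] join Con_le_Nabla[OF J] by blast
  qed (rule cjoin_upper)+
  \<comment> \<open>This lift modulo \<chi> is also the witness modulo \<theta>; the rest shows that
    \<gamma> \<or> \<theta> equals \<phi>.\<close>
  then obtain \<gamma> where \<gamma>B: "\<gamma> \<in> BCon ar A"
    and eq: "quot_con \<chi> (cjoin ar A \<gamma> \<chi>) = quot_con \<chi> (cjoin ar A \<phi> \<chi>)"
    using cblp unfolding CBLP_def by blast
  then obtain \<gamma>' where \<gamma>: "\<gamma> \<in> Con ar A" and \<gamma>': "\<gamma>' \<in> Con ar A"
    and \<gamma>_meet: "\<gamma> \<inter> \<gamma>' = Delta A" and \<gamma>_join: "cjoin ar A \<gamma> \<gamma>' = Nabla A"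
    by (auto simp: BCon_def)
  have same: "cjoin ar A \<gamma> \<chi> = cjoin ar A \<phi> \<chi>"
    by (rule quot_con_inj[OF alg \<chi> cjoin_Con[OF alg \<gamma> \<chi>] _ \<phi>\<chi> _ eq]) (rule cjoin_upper)+
  let ?\<epsilon> = "cjoin ar A \<gamma> \<theta>"
  have \<epsilon>: "?\<epsilon> \<in> Con ar A" by (rule cjoin_Con[OF alg \<gamma> \<theta>])
  have "cjoin ar A \<psi> ?\<epsilon> = Nabla A"
  proof (rule max)
    show "cjoin ar A \<psi> ?\<epsilon> \<in> Con ar A" by (rule cjoin_Con[OF alg \<psi>(1) \<epsilon>])
    show "\<theta> \<subseteq> cjoin ar A \<psi> ?\<epsilon>" using \<psi>(2) cjoin_upper(1) by (rule subset_trans)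
    fix \<mu> assume \<mu>: "\<mu> \<in> Con ar A" "cjoin ar A \<psi> ?\<epsilon> \<subseteq> \<mu>" "\<chi> \<subseteq> \<mu>"
    have "\<psi> \<subseteq> \<mu>" "\<gamma> \<subseteq> \<mu>"
      using \<mu>(2) cjoin_upper[of \<psi> ar A ?\<epsilon>] cjoin_upper(2)[of ?\<epsilon> ar A \<psi>] cjoin_upper(1)[of \<gamma> ar A \<theta>] by blast+
    \<comment> \<open>As \<mu> contains \<chi> and \<gamma>, it contains their join, which by
      \<open>same\<close> is above \<phi>.\<close>
    moreover from this have "\<phi> \<subseteq> \<mu>"
      using cjoin_least[OF \<mu>(1) _ \<mu>(3), of \<gamma>] cjoin_upper(1)[of \<phi> ar A \<chi>] same by blast
    ultimately show "Nabla A \<subseteq> \<mu>" using cjoin_least[OF \<mu>(1), of \<phi> \<psi>] join by blast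
  qed
  moreover have "cjoin ar A \<phi> ?\<epsilon> \<inter> cjoin ar A \<psi> ?\<epsilon> = ?\<epsilon>"
    using comaximal_distrib[OF A \<phi>(1) \<psi>(1) \<epsilon>] meet join cjoin_upper(2)[of \<theta> ar A \<gamma>] by simp
  \<comment> \<open>With \<psi> \<or> \<epsilon> total, the distributive law reduces to \<phi> \<or>
    \<epsilon> = \<epsilon>.\<close>
  ultimately have le: "\<phi> \<subseteq> ?\<epsilon>"
    using cjoin_upper(1)[of \<phi> ar A ?\<epsilon>] Con_le_Nabla[OF \<phi>(1)] by blast
  have "cjoin ar A \<gamma>' \<phi> = Nabla A"
  proof (rule max)
    show "cjoin ar A \<gamma>' \<phi> \<in> Con ar A" by (rule cjoin_Con[OF alg \<gamma>' \<phi>(1)])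
    show "\<theta> \<subseteq> cjoin ar A \<gamma>' \<phi>" using \<phi>(2) cjoin_upper(2) by (rule subset_trans)
    fix \<mu> assume \<mu>: "\<mu> \<in> Con ar A" "cjoin ar A \<gamma>' \<phi> \<subseteq> \<mu>" "\<chi> \<subseteq> \<mu>"
    have "\<gamma>' \<subseteq> \<mu>" "\<phi> \<subseteq> \<mu>"
      using \<mu>(2) cjoin_upper[of \<gamma>' ar A \<phi>] cjoin_upper(2)[of \<phi> ar A \<gamma>'] by blast+
    moreover from this have "\<gamma> \<subseteq> \<mu>"
      using cjoin_least[OF \<mu>(1) _ \<mu>(3), of \<phi>] cjoin_upper(1)[of \<gamma> ar A \<chi>] same by blast
    ultimately show "Nabla A \<subseteq> \<mu>" using cjoin_least[OF \<mu>(1), of \<gamma> \<gamma>'] \<gamma>_join by blast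
  qed
  \<comment> \<open>The same cancellation is now applied to the complementary pair of A itself, over
    \<phi>.\<close>
  moreover have "\<gamma> \<inter> \<gamma>' \<subseteq> \<phi>" unfolding \<gamma>_meet by (auto simp: Delta_def intro: Con_refl[OF \<phi>(1)])
  then have "cjoin ar A \<gamma> \<phi> \<inter> cjoin ar A \<gamma>' \<phi> = \<phi>"
    by (rule comaximal_distrib[OF A \<gamma> \<gamma>' \<phi>(1) _ \<gamma>_join])
  ultimately have "\<gamma> \<subseteq> \<phi>"
    using cjoin_upper(1)[of \<gamma> ar A \<phi>] Con_le_Nabla[OF \<gamma>] by blast
  then have "?\<epsilon> = \<phi>" using le cjoin_least[OF \<phi>(1) _ \<phi>(2), of \<gamma>] by blast
  then show "\<exists>\<alpha>\<in>BCon ar A. quot_con \<theta> (cjoin ar A \<alpha> \<theta>) = \<beta>" using \<gamma>B \<beta> by blast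
qed

theorem theorem5p12:
  fixes ar :: "'f \<Rightarrow> nat"
    and E :: "(('f, nat) trm \<times> ('f, nat) trm) set"
    and A :: "('f, 'u) alg"
    and \<theta> \<chi> :: "('u \<times> 'u) set"
  assumes fin_sig: "finite (UNIV :: 'f set)"
    and wf_E: "\<forall>(s, t)\<in>E. wf_trm ar s \<and> wf_trm ar t"
    and big_universe: "infinite (UNIV :: 'u set)"
    and cm: "\<forall>B :: ('f, 'u) alg. in_var ar E B \<longrightarrow> modular_con ar B"
    and semideg: "\<forall>B :: ('f, 'u) alg. in_var ar E B \<and> nontrivial B \<longrightarrow> \<not> one_elem_subalg ar B"
    and K_comm: "\<forall>B :: ('f, 'u) alg. in_var ar E B \<longrightarrow>
                   (\<forall>\<alpha>\<in>K ar B. \<forall>\<beta>\<in>K ar B. comm ar B \<alpha> \<beta> \<in> K ar B)"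
    and ret_bc: "\<forall>B :: ('f, 'u) alg. in_var ar E B \<longrightarrow> ret_preserves_bc ar B"
    and A_in: "in_var ar E A"
    and \<theta>_con: "\<theta> \<in> Con ar A"
    and \<chi>_con: "\<chi> \<in> Con ar A"
    and sub: "\<theta> \<subseteq> \<chi>"
    and max_eq: "{\<mu> \<in> MaxCon ar A. \<theta> \<subseteq> \<mu>} = {\<mu> \<in> MaxCon ar A. \<chi> \<subseteq> \<mu>}"
    and cblp: "CBLP ar A \<chi>"
  shows "CBLP ar A \<theta>"
proof -
  \<comment> \<open>An infinite type is equinumerous with its square; the bijection codes pairs and,
    iterated, triples.\<close>
  obtain code :: "'u \<times> 'u \<Rightarrow> 'u" where "bij_betw code (UNIV \<times> UNIV) UNIV"
    using card_of_Times_same_infinite[OF big_universe]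
      card_of_ordIso[of "UNIV \<times> UNIV :: ('u \<times> 'u) set" "UNIV :: 'u set"] by blast
  then have "inj code" by (simp add: bij_betw_def)
  then interpret cm_semidegenerate ar E code
    by unfold_locales (use fin_sig wf_E cm semideg in auto)
  show ?thesis
    by (rule CBLP_of_same_MaxCon[OF A_in \<theta>_con \<chi>_con sub max_eq cblp])
qed

end
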